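(* Let $\sigma$ be a signature. For all sets $\Gamma\subseteq\mathrm{Sent}_\sigma$ and $\Delta\subseteq\mathrm{Form}_\sigma$: $\Gamma\vdash_{\mathsf{QB3K}}\Delta$ if and only if $\Gamma\vDash_{\mathsf{QB3K}}\Delta$.
   Context: Syntax. Signature $\sigma$: predicate symbols (with arities) and constants, no function symbols; terms are variables (fixed countable set) and constants. $\mathrm{Form}_\sigma$: formulas built from atomic formulas and $\bot$ by $\rightarrow,\wedge,\vee$, strong negation $\sim$, $\Box,\Diamond$, $\forall x,\exists x$; $\mathrm{Sent}_\sigma$: sentences. Abbreviations: $\neg\Phi:=\Phi\rightarrow\bot$, $\Phi\leftrightarrow\Psi:=(\Phi\rightarrow\Psi)\wedge(\Psi\rightarrow\Phi)$, $\Phi\Leftrightarrow\Psi:=(\Phi\leftrightarrow\Psi)\wedge({\sim\Phi}\leftrightarrow{\sim\Psi})$. Calculus. $\mathsf{QB3K}_\sigma$ is the smallest set of $\sigma$-formulas containing all instances of the following schemes and closed under the rules below: $\Phi\rightarrow(\Psi\rightarrow\Phi)$; $(\Phi\rightarrow(\Psi\rightarrow\Theta))\rightarrow((\Phi\rightarrow\Psi)\rightarrow(\Phi\rightarrow\Theta))$; $\Phi\wedge\Psi\rightarrow\Phi$; $\Phi\wedge\Psi\rightarrow\Psi$; $\Phi\rightarrow(\Psi\rightarrow\Phi\wedge\Psi)$; $\Phi\rightarrow\Phi\vee\Psi$; $\Psi\rightarrow\Phi\vee\Psi$; $(\Phi\rightarrow\Theta)\rightarrow((\Psi\rightarrow\Theta)\rightarrow(\Phi\vee\Psi\rightarrow\Theta))$;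 $\Phi\vee(\Phi\rightarrow\bot)$; $\bot\rightarrow\Phi$; ${\sim\sim\Phi}\leftrightarrow\Phi$; ${\sim(\Phi\rightarrow\Psi)}\leftrightarrow(\Phi\wedge{\sim\Psi})$; ${\sim(\Phi\vee\Psi)}\leftrightarrow({\sim\Phi}\wedge{\sim\Psi})$; ${\sim(\Phi\wedge\Psi)}\leftrightarrow({\sim\Phi}\vee{\sim\Psi})$; ${\sim\bot}$; $(\Box\Phi\wedge\Box\Psi)\rightarrow\Box(\Phi\wedge\Psi)$; $\Box(\Phi\rightarrow\Phi)$; $\neg\Box\Phi\leftrightarrow\Diamond\neg\Phi$; $\neg\Diamond\Phi\leftrightarrow\Box\neg\Phi$; $\Box\Phi\Leftrightarrow{\sim\Diamond{\sim\Phi}}$; $\Diamond\Phi\Leftrightarrow{\sim\Box{\sim\Phi}}$; $\forall x\Phi\rightarrow\Phi(x/t)$, $\Phi(x/t)\rightarrow\exists x\Phi$ ($t$ free for $x$ in $\Phi$); ${\sim\forall x\Phi}\leftrightarrow\exists x{\sim\Phi}$; ${\sim\exists x\Phi}\leftrightarrow\forall x{\sim\Phi}$; and additionally ${\sim\Phi}\rightarrow(\Phi\rightarrow\Psi)$. Rules: MP (from $\Phi,\Phi\rightarrow\Psi$ infer $\Psi$), MB (from $\Phi\rightarrow\Psi$ infer $\Box\Phi\rightarrow\Box\Psi$), MD (from $\Phi\rightarrow\Psi$ infer $\Diamond\Phi\rightarrow\Diamond\Psi$), BR1 (from $\Phi\rightarrow\Psi$ infer $\Phi\rightarrow\forall x\Psi$,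 $x$ not free in $\Phi$), BR2 (from $\Phi\rightarrow\Psi$ infer $\exists x\Phi\rightarrow\Psi$, $x$ not free in $\Psi$). $\mathrm{Disj}(\Delta)$: disjunctions of finitely many elements of $\Delta$ (empty $=\bot$). $\Gamma\vdash_{\mathsf{QB3K}}\Delta$ iff some element of $\mathrm{Disj}(\Delta)$ is obtainable from $\Gamma\cup\mathsf{QB3K}_\sigma$ using only MP, BR1, BR2. Semantics. A $\mathsf{QBK}_\sigma$-model is $\mathcal M=\langle\langle W,R\rangle,(\mathfrak A^+_w),(\mathfrak A^-_w)\rangle$ ($W\ne\emptyset$, $R\subseteq W\times W$), $\mathfrak A^\pm_w$ $\sigma$-structures with common domain $A_w$ and equal interpretation of constants, with $uRv\Rightarrow A_u\subseteq A_v$ and constants of $\sigma$ interpreted equally in $\mathfrak A^+_u,\mathfrak A^+_v$. A $\mathsf{QB3K}_\sigma$-model is a $\mathsf{QBK}_\sigma$-model such that for no world $w$ is there an atomic sentence $\Phi$ with both $\mathfrak A^+_w\models\Phi$ and $\mathfrak A^-_w\models\Phi$. $A$-sentences: sentences over $\sigma$ plus constants $\underline a$ ($a\in A$) naming $a$; ground $A$-substitutions map variables to such constants. Verification/falsification at $w$: atomic by $\mathfrak A^+_w$ / $\mathfrak A^-_w$; $\bot$ never verified, always falsified; $\wedge$: verified iff both verified, falsified iff one falsified; $\vee$ dually; $\Phi\rightarrow\Psi$: verified iff $\Phi$ not verified or $\Psi$ verified, falsified iff $\Phi$ verified and $\Psi$ falsified; $\sim$ swaps; $\Box\Phi$: verified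 iff $\Phi$ verified at all $R$-successors, falsified iff falsified at some $R$-successor; $\Diamond\Phi$: verified iff verified at some $R$-successor, falsified iff falsified at all; $\forall x\Phi$: verified iff $\Phi(x/\underline a)$ verified for all $a\in A_w$, falsified iff falsified for some; $\exists x\Phi$: verified iff verified for some $a\in A_w$, falsified iff falsified for all. $\Gamma\vDash_{\mathsf{QB3K}}\Delta$ iff for every $\mathsf{QB3K}_\sigma$-model $\mathcal M$, world $w$, ground $A_w$-substitution $\lambda$: if all of $\Gamma$ is verified at $w$ then $\lambda\Psi$ is verified at $w$ for some $\Psi\in\Delta$. *)

theory Defs
  imports Main
begin

datatype 'c trm = Var nat | Cst 'c

datatype ('p, 'c) fm =
    Atom 'p "'c trm list"
  | Bot
  | Imp "('p, 'c) fm" "('p, 'c) fm"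
  | And "('p, 'c) fm" "('p, 'c) fm"
  | Or "('p, 'c) fm" "('p, 'c) fm"
  | SNeg "('p, 'c) fm"
  | Box "('p, 'c) fm"
  | Dia "('p, 'c) fm"
  | All nat "('p, 'c) fm"
  | Ex nat "('p, 'c) fm"

abbreviation Neg :: "('p, 'c) fm \<Rightarrow> ('p, 'c) fm" where
  "Neg \<Phi> \<equiv> Imp \<Phi> Bot"

abbreviation Iff :: "('p, 'c) fm \<Rightarrow> ('p, 'c) fm \<Rightarrow> ('p, 'c) fm" where
  "Iff \<Phi> \<Psi> \<equiv> And (Imp \<Phi> \<Psi>) (Imp \<Psi> \<Phi>)"

abbreviation SIff :: "('p, 'c) fm \<Rightarrow> ('p, 'c) fm \<Rightarrow> ('p, 'c) fm" where
  "SIff \<Phi> \<Psi> \<equiv> And (Iff \<Phi> \<Psi>) (Iff (SNeg \<Phi>) (SNeg \<Psi>))"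

text \<open>The sets of symbols may be empty and of any cardinality; the values of \<open>arity\<close> outside
  \<open>psyms\<close> are irrelevant.\<close>

record ('p, 'c) signature =
  psyms :: "'p set"
  arity :: "'p \<Rightarrow> nat"
  csyms :: "'c set"

fun fv_trm :: "'c trm \<Rightarrow> nat set" where
  "fv_trm (Var x) = {x}"
| "fv_trm (Cst c) = {}"

fun fv :: "('p, 'c) fm \<Rightarrow> nat set" where
  "fv (Atom p ts) = (\<Union>t\<in>set ts. fv_trm t)"
| "fv Bot = {}"
| "fv (Imp \<Phi> \<Psi>) = fv \<Phi> \<union> fv \<Psi>"
| "fv (And \<Phi> \<Psi>) = fv \<Phi> \<union> fv \<Psi>"
| "fv (Or \<Phi> \<Psi>) = fv \<Phi> \<union> fv \<Psi>"
| "fv (SNeg \<Phi>) = fv \<Phi>"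
| "fv (Box \<Phi>) = fv \<Phi>"
| "fv (Dia \<Phi>) = fv \<Phi>"
| "fv (All x \<Phi>) = fv \<Phi> - {x}"
| "fv (Ex x \<Phi>) = fv \<Phi> - {x}"

fun wf_trm :: "('p, 'c) signature \<Rightarrow> 'c trm \<Rightarrow> bool" where
  "wf_trm \<sigma> (Var x) = True"
| "wf_trm \<sigma> (Cst c) = (c \<in> csyms \<sigma>)"

fun wf_fm :: "('p, 'c) signature \<Rightarrow> ('p, 'c) fm \<Rightarrow> bool" where
  "wf_fm \<sigma> (Atom p ts) = (p \<in> psyms \<sigma> \<and> length ts = arity \<sigma> p \<and> (\<forall>t\<in>set ts. wf_trm \<sigma> t))"
| "wf_fm \<sigma> Bot = True"
| "wf_fm \<sigma> (Imp \<Phi> \<Psi>) = (wf_fm \<sigma> \<Phi> \<and> wf_fm \<sigma> \<Psi>)"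
| "wf_fm \<sigma> (And \<Phi> \<Psi>) = (wf_fm \<sigma> \<Phi> \<and> wf_fm \<sigma> \<Psi>)"
| "wf_fm \<sigma> (Or \<Phi> \<Psi>) = (wf_fm \<sigma> \<Phi> \<and> wf_fm \<sigma> \<Psi>)"
| "wf_fm \<sigma> (SNeg \<Phi>) = wf_fm \<sigma> \<Phi>"
| "wf_fm \<sigma> (Box \<Phi>) = wf_fm \<sigma> \<Phi>"
| "wf_fm \<sigma> (Dia \<Phi>) = wf_fm \<sigma> \<Phi>"
| "wf_fm \<sigma> (All x \<Phi>) = wf_fm \<sigma> \<Phi>"
| "wf_fm \<sigma> (Ex x \<Phi>) = wf_fm \<sigma> \<Phi>"

definition Form :: "('p, 'c) signature \<Rightarrow> ('p, 'c) fm set" where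
  "Form \<sigma> = {\<Phi>. wf_fm \<sigma> \<Phi>}"

definition Sent :: "('p, 'c) signature \<Rightarrow> ('p, 'c) fm set" where
  "Sent \<sigma> = {\<Phi> \<in> Form \<sigma>. fv \<Phi> = {}}"

fun subst_trm :: "(nat \<Rightarrow> 'c trm) \<Rightarrow> 'c trm \<Rightarrow> 'c trm" where
  "subst_trm s (Var x) = s x"
| "subst_trm s (Cst c) = Cst c"

text \<open>Simultaneous substitution for the free occurrences of variables. It does not rename bound
  variables, so capture has to be excluded by \<open>free_for\<close> below.\<close>

fun subst :: "(nat \<Rightarrow> 'c trm) \<Rightarrow> ('p, 'c) fm \<Rightarrow> ('p, 'c) fm" where
  "subst s (Atom p ts) = Atom p (map (subst_trm s) ts)"
| "subst s Bot = Bot"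
| "subst s (Imp \<Phi> \<Psi>) = Imp (subst s \<Phi>) (subst s \<Psi>)"
| "subst s (And \<Phi> \<Psi>) = And (subst s \<Phi>) (subst s \<Psi>)"
| "subst s (Or \<Phi> \<Psi>) = Or (subst s \<Phi>) (subst s \<Psi>)"
| "subst s (SNeg \<Phi>) = SNeg (subst s \<Phi>)"
| "subst s (Box \<Phi>) = Box (subst s \<Phi>)"
| "subst s (Dia \<Phi>) = Dia (subst s \<Phi>)"
| "subst s (All x \<Phi>) = All x (subst (s(x := Var x)) \<Phi>)"
| "subst s (Ex x \<Phi>) = Ex x (subst (s(x := Var x)) \<Phi>)"

definition subst1 :: "nat \<Rightarrow> 'c trm \<Rightarrow> ('p, 'c) fm \<Rightarrow> ('p, 'c) fm" where
  "subst1 x t \<Phi> = subst (Var(x := t)) \<Phi>"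

fun free_for :: "'c trm \<Rightarrow> nat \<Rightarrow> ('p, 'c) fm \<Rightarrow> bool" where
  "free_for t x (Atom p ts) = True"
| "free_for t x Bot = True"
| "free_for t x (Imp \<Phi> \<Psi>) = (free_for t x \<Phi> \<and> free_for t x \<Psi>)"
| "free_for t x (And \<Phi> \<Psi>) = (free_for t x \<Phi> \<and> free_for t x \<Psi>)"
| "free_for t x (Or \<Phi> \<Psi>) = (free_for t x \<Phi> \<and> free_for t x \<Psi>)"
| "free_for t x (SNeg \<Phi>) = free_for t x \<Phi>"
| "free_for t x (Box \<Phi>) = free_for t x \<Phi>"
| "free_for t x (Dia \<Phi>) = free_for t x \<Phi>"
| "free_for t x (All y \<Phi>) = (x \<notin> fv (All y \<Phi>) \<or> (y \<notin> fv_trm t \<and> free_for t x \<Phi>))"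
| "free_for t x (Ex y \<Phi>) = (x \<notin> fv (Ex y \<Phi>) \<or> (y \<notin> fv_trm t \<and> free_for t x \<Phi>))"

inductive_set QB3K_axioms :: "('p, 'c) fm set" where
  "Imp \<Phi> (Imp \<Psi> \<Phi>) \<in> QB3K_axioms"
| "Imp (Imp \<Phi> (Imp \<Psi> \<Theta>)) (Imp (Imp \<Phi> \<Psi>) (Imp \<Phi> \<Theta>)) \<in> QB3K_axioms"
| "Imp (And \<Phi> \<Psi>) \<Phi> \<in> QB3K_axioms"
| "Imp (And \<Phi> \<Psi>) \<Psi> \<in> QB3K_axioms"
| "Imp \<Phi> (Imp \<Psi> (And \<Phi> \<Psi>)) \<in> QB3K_axioms"
| "Imp \<Phi> (Or \<Phi> \<Psi>) \<in> QB3K_axioms"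
| "Imp \<Psi> (Or \<Phi> \<Psi>) \<in> QB3K_axioms"
| "Imp (Imp \<Phi> \<Theta>) (Imp (Imp \<Psi> \<Theta>) (Imp (Or \<Phi> \<Psi>) \<Theta>)) \<in> QB3K_axioms"
| "Or \<Phi> (Imp \<Phi> Bot) \<in> QB3K_axioms"
| "Imp Bot \<Phi> \<in> QB3K_axioms"
| "Iff (SNeg (SNeg \<Phi>)) \<Phi> \<in> QB3K_axioms"
| "Iff (SNeg (Imp \<Phi> \<Psi>)) (And \<Phi> (SNeg \<Psi>)) \<in> QB3K_axioms"
| "Iff (SNeg (Or \<Phi> \<Psi>)) (And (SNeg \<Phi>) (SNeg \<Psi>)) \<in> QB3K_axioms"
| "Iff (SNeg (And \<Phi> \<Psi>)) (Or (SNeg \<Phi>) (SNeg \<Psi>)) \<in> QB3K_axioms"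
| "SNeg Bot \<in> QB3K_axioms"
| "Imp (And (Box \<Phi>) (Box \<Psi>)) (Box (And \<Phi> \<Psi>)) \<in> QB3K_axioms"
| "Box (Imp \<Phi> \<Phi>) \<in> QB3K_axioms"
| "Iff (Neg (Box \<Phi>)) (Dia (Neg \<Phi>)) \<in> QB3K_axioms"
| "Iff (Neg (Dia \<Phi>)) (Box (Neg \<Phi>)) \<in> QB3K_axioms"
| "SIff (Box \<Phi>) (SNeg (Dia (SNeg \<Phi>))) \<in> QB3K_axioms"
| "SIff (Dia \<Phi>) (SNeg (Box (SNeg \<Phi>))) \<in> QB3K_axioms"
| "free_for t x \<Phi> \<Longrightarrow> Imp (All x \<Phi>) (subst1 x t \<Phi>) \<in> QB3K_axioms"
| "free_for t x \<Phi> \<Longrightarrow> Imp (subst1 x t \<Phi>) (Ex x \<Phi>) \<in> QB3K_axioms"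
| "Iff (SNeg (All x \<Phi>)) (Ex x (SNeg \<Phi>)) \<in> QB3K_axioms"
| "Iff (SNeg (Ex x \<Phi>)) (All x (SNeg \<Phi>)) \<in> QB3K_axioms"
| "Imp (SNeg \<Phi>) (Imp \<Phi> \<Psi>) \<in> QB3K_axioms"

inductive_set QB3K :: "('p, 'c) signature \<Rightarrow> ('p, 'c) fm set" for \<sigma> where
  Ax: "\<Phi> \<in> QB3K_axioms \<Longrightarrow> \<Phi> \<in> Form \<sigma> \<Longrightarrow> \<Phi> \<in> QB3K \<sigma>"
| MP: "\<Phi> \<in> QB3K \<sigma> \<Longrightarrow> Imp \<Phi> \<Psi> \<in> QB3K \<sigma> \<Longrightarrow> \<Psi> \<in> QB3K \<sigma>"
| MB: "Imp \<Phi> \<Psi> \<in> QB3K \<sigma> \<Longrightarrow> Imp (Box \<Phi>) (Box \<Psi>) \<in> QB3K \<sigma>"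
| MD: "Imp \<Phi> \<Psi> \<in> QB3K \<sigma> \<Longrightarrow> Imp (Dia \<Phi>) (Dia \<Psi>) \<in> QB3K \<sigma>"
| BR1: "Imp \<Phi> \<Psi> \<in> QB3K \<sigma> \<Longrightarrow> x \<notin> fv \<Phi> \<Longrightarrow> Imp \<Phi> (All x \<Psi>) \<in> QB3K \<sigma>"
| BR2: "Imp \<Phi> \<Psi> \<in> QB3K \<sigma> \<Longrightarrow> x \<notin> fv \<Psi> \<Longrightarrow> Imp (Ex x \<Phi>) \<Psi> \<in> QB3K \<sigma>"

inductive_set obtainable :: "('p, 'c) fm set \<Rightarrow> ('p, 'c) fm set" for X where
  Hyp: "\<Phi> \<in> X \<Longrightarrow> \<Phi> \<in> obtainable X"
| MP: "\<Phi> \<in> obtainable X \<Longrightarrow> Imp \<Phi> \<Psi> \<in> obtainable X \<Longrightarrow> \<Psi> \<in> obtainable X"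
| BR1: "Imp \<Phi> \<Psi> \<in> obtainable X \<Longrightarrow> x \<notin> fv \<Phi> \<Longrightarrow> Imp \<Phi> (All x \<Psi>) \<in> obtainable X"
| BR2: "Imp \<Phi> \<Psi> \<in> obtainable X \<Longrightarrow> x \<notin> fv \<Psi> \<Longrightarrow> Imp (Ex x \<Phi>) \<Psi> \<in> obtainable X"

fun disj :: "('p, 'c) fm list \<Rightarrow> ('p, 'c) fm" where
  "disj [] = Bot"
| "disj [\<Phi>] = \<Phi>"
| "disj (\<Phi> # \<Psi> # \<Phi>s) = Or \<Phi> (disj (\<Psi> # \<Phi>s))"

definition Disj :: "('p, 'c) fm set \<Rightarrow> ('p, 'c) fm set" where
  "Disj \<Delta> = {disj \<Phi>s | \<Phi>s. set \<Phi>s \<subseteq> \<Delta>}"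

definition QB3K_derives :: "('p, 'c) signature \<Rightarrow> ('p, 'c) fm set \<Rightarrow> ('p, 'c) fm set \<Rightarrow> bool" where
  "QB3K_derives \<sigma> \<Gamma> \<Delta> \<longleftrightarrow> (\<exists>\<Phi> \<in> Disj \<Delta>. \<Phi> \<in> obtainable (\<Gamma> \<union> QB3K \<sigma>))"

record ('p, 'c, 'a) struct =
  domain :: "'a set"
  cint :: "'c \<Rightarrow> 'a"
  pint :: "'p \<Rightarrow> 'a list set"

definition is_struct :: "('p, 'c) signature \<Rightarrow> ('p, 'c, 'a) struct \<Rightarrow> bool" where
  "is_struct \<sigma> \<AA> \<longleftrightarrow>
     domain \<AA> \<noteq> {} \<and>
     (\<forall>c\<in>csyms \<sigma>. cint \<AA> c \<in> domain \<AA>) \<and>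
     (\<forall>p\<in>psyms \<sigma>. pint \<AA> p \<subseteq> {as. length as = arity \<sigma> p \<and> set as \<subseteq> domain \<AA>})"

text \<open>The \<open>A\<close>-formulas over a signature with constants in \<open>'c\<close> are formulas with constants in
  \<open>'c + 'a\<close>, where \<open>Inr a\<close> is the constant naming \<open>a\<close>.\<close>

definition expand :: "('p, 'c) signature \<Rightarrow> 'a set \<Rightarrow> ('p, 'c + 'a) signature" where
  "expand \<sigma> A = \<lparr>psyms = psyms \<sigma>, arity = arity \<sigma>, csyms = Inl ` csyms \<sigma> \<union> Inr ` A\<rparr>"

abbreviation lift_fm :: "('p, 'c) fm \<Rightarrow> ('p, 'c + 'a) fm" where
  "lift_fm \<equiv> map_fm (\<lambda>p. p) Inl"

abbreviation name :: "'a \<Rightarrow> ('c + 'a) trm" where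
  "name a \<equiv> Cst (Inr a)"

fun tval :: "('p, 'c, 'a) struct \<Rightarrow> ('c + 'a) trm \<Rightarrow> 'a" where
  "tval \<AA> (Cst (Inl c)) = cint \<AA> c"
| "tval \<AA> (Cst (Inr a)) = a"
| "tval \<AA> (Var x) = undefined"

definition sat_atom :: "('p, 'c, 'a) struct \<Rightarrow> 'p \<Rightarrow> ('c + 'a) trm list \<Rightarrow> bool" where
  "sat_atom \<AA> p ts \<longleftrightarrow> map (tval \<AA>) ts \<in> pint \<AA> p"

record ('p, 'c, 'w, 'a) model =
  worlds :: "'w set"
  acc :: "('w \<times> 'w) set"
  pos :: "'w \<Rightarrow> ('p, 'c, 'a) struct"
  neg :: "'w \<Rightarrow> ('p, 'c, 'a) struct"

definition QBK_model :: "('p, 'c) signature \<Rightarrow> ('p, 'c, 'w, 'a) model \<Rightarrow> bool" where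
  "QBK_model \<sigma> M \<longleftrightarrow>
     worlds M \<noteq> {} \<and>
     acc M \<subseteq> worlds M \<times> worlds M \<and>
     (\<forall>w\<in>worlds M.
        is_struct \<sigma> (pos M w) \<and> is_struct \<sigma> (neg M w) \<and>
        domain (pos M w) = domain (neg M w) \<and>
        (\<forall>c\<in>csyms \<sigma>. cint (pos M w) c = cint (neg M w) c)) \<and>
     (\<forall>(u, v)\<in>acc M.
        domain (pos M u) \<subseteq> domain (pos M v) \<and>
        (\<forall>c\<in>csyms \<sigma>. cint (pos M u) c = cint (pos M v) c))"

text \<open>The atomic sentences in question are the atomic \<open>A\<^sub>w\<close>-sentences: with atomic sentences
  of \<open>\<sigma>\<close> alone the condition would be void for signatures without constants, and
  \<open>\<sim>\<Phi> \<rightarrow> (\<Phi> \<rightarrow> \<Psi>)\<close> would not be valid.\<close>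

definition QB3K_model :: "('p, 'c) signature \<Rightarrow> ('p, 'c, 'w, 'a) model \<Rightarrow> bool" where
  "QB3K_model \<sigma> M \<longleftrightarrow>
     QBK_model \<sigma> M \<and>
     (\<forall>w\<in>worlds M. \<not> (\<exists>p ts. Atom p ts \<in> Sent (expand \<sigma> (domain (pos M w))) \<and>
        sat_atom (pos M w) p ts \<and> sat_atom (neg M w) p ts))"

fun depth :: "('p, 'c) fm \<Rightarrow> nat" where
  "depth (Atom p ts) = 0"
| "depth Bot = 0"
| "depth (Imp \<Phi> \<Psi>) = Suc (max (depth \<Phi>) (depth \<Psi>))"
| "depth (And \<Phi> \<Psi>) = Suc (max (depth \<Phi>) (depth \<Psi>))"
| "depth (Or \<Phi> \<Psi>) = Suc (max (depth \<Phi>) (depth \<Psi>))"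
| "depth (SNeg \<Phi>) = Suc (depth \<Phi>)"
| "depth (Box \<Phi>) = Suc (depth \<Phi>)"
| "depth (Dia \<Phi>) = Suc (depth \<Phi>)"
| "depth (All x \<Phi>) = Suc (depth \<Phi>)"
| "depth (Ex x \<Phi>) = Suc (depth \<Phi>)"

lemma depth_subst [simp]: "depth (subst s \<Phi>) = depth \<Phi>"
  by (induction \<Phi> arbitrary: s) auto

lemma depth_subst1 [simp]: "depth (subst1 x t \<Phi>) = depth \<Phi>"
  by (simp add: subst1_def)

function verified :: "('p, 'c, 'w, 'a) model \<Rightarrow> 'w \<Rightarrow> ('p, 'c + 'a) fm \<Rightarrow> bool"
  and falsified :: "('p, 'c, 'w, 'a) model \<Rightarrow> 'w \<Rightarrow> ('p, 'c + 'a) fm \<Rightarrow> bool"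
where
  "verified M w (Atom p ts) \<longleftrightarrow> sat_atom (pos M w) p ts"
| "verified M w Bot \<longleftrightarrow> False"
| "verified M w (Imp \<Phi> \<Psi>) \<longleftrightarrow> \<not> verified M w \<Phi> \<or> verified M w \<Psi>"
| "verified M w (And \<Phi> \<Psi>) \<longleftrightarrow> verified M w \<Phi> \<and> verified M w \<Psi>"
| "verified M w (Or \<Phi> \<Psi>) \<longleftrightarrow> verified M w \<Phi> \<or> verified M w \<Psi>"
| "verified M w (SNeg \<Phi>) \<longleftrightarrow> falsified M w \<Phi>"
| "verified M w (Box \<Phi>) \<longleftrightarrow> (\<forall>v. (w, v) \<in> acc M \<longrightarrow> verified M v \<Phi>)"
| "verified M w (Dia \<Phi>) \<longleftrightarrow> (\<exists>v. (w, v) \<in> acc M \<and> verified M v \<Phi>)"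
| "verified M w (All x \<Phi>) \<longleftrightarrow> (\<forall>a\<in>domain (pos M w). verified M w (subst1 x (name a) \<Phi>))"
| "verified M w (Ex x \<Phi>) \<longleftrightarrow> (\<exists>a\<in>domain (pos M w). verified M w (subst1 x (name a) \<Phi>))"
| "falsified M w (Atom p ts) \<longleftrightarrow> sat_atom (neg M w) p ts"
| "falsified M w Bot \<longleftrightarrow> True"
| "falsified M w (Imp \<Phi> \<Psi>) \<longleftrightarrow> verified M w \<Phi> \<and> falsified M w \<Psi>"
| "falsified M w (And \<Phi> \<Psi>) \<longleftrightarrow> falsified M w \<Phi> \<or> falsified M w \<Psi>"
| "falsified M w (Or \<Phi> \<Psi>) \<longleftrightarrow> falsified M w \<Phi> \<and> falsified M w \<Psi>"
| "falsified M w (SNeg \<Phi>) \<longleftrightarrow> verified M w \<Phi>"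
| "falsified M w (Box \<Phi>) \<longleftrightarrow> (\<exists>v. (w, v) \<in> acc M \<and> falsified M v \<Phi>)"
| "falsified M w (Dia \<Phi>) \<longleftrightarrow> (\<forall>v. (w, v) \<in> acc M \<longrightarrow> falsified M v \<Phi>)"
| "falsified M w (All x \<Phi>) \<longleftrightarrow> (\<exists>a\<in>domain (pos M w). falsified M w (subst1 x (name a) \<Phi>))"
| "falsified M w (Ex x \<Phi>) \<longleftrightarrow> (\<forall>a\<in>domain (pos M w). falsified M w (subst1 x (name a) \<Phi>))"
  by pat_completeness auto
termination
  by (relation "measure (\<lambda>z. case z of Inl (M, w, \<Phi>) \<Rightarrow> depth \<Phi> | Inr (M, w, \<Phi>) \<Rightarrow> depth \<Phi>)") auto

definition ground_subst :: "'a set \<Rightarrow> (nat \<Rightarrow> ('c + 'a) trm) \<Rightarrow> bool" where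
  "ground_subst A l \<longleftrightarrow> (\<forall>x. \<exists>a\<in>A. l x = name a)"

text \<open>Consequence over the models whose worlds and individuals are taken from the given types.\<close>

definition QB3K_entails ::
  "'w itself \<Rightarrow> 'a itself \<Rightarrow> ('p, 'c) signature \<Rightarrow> ('p, 'c) fm set \<Rightarrow> ('p, 'c) fm set \<Rightarrow> bool"
where
  "QB3K_entails TYPE('w) TYPE('a) \<sigma> \<Gamma> \<Delta> \<longleftrightarrow>
     (\<forall>(M :: ('p, 'c, 'w, 'a) model) w l.
        QB3K_model \<sigma> M \<longrightarrow> w \<in> worlds M \<longrightarrow> ground_subst (domain (pos M w)) l \<longrightarrow>
        (\<forall>\<Phi>\<in>\<Gamma>. verified M w (lift_fm \<Phi>)) \<longrightarrow>
        (\<exists>\<Psi>\<in>\<Delta>. verified M w (subst l (lift_fm \<Psi>))))"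

text \<open>HOL cannot quantify over types inside a formula, so ``every model'' needs a universe that is
  large enough for canonical models: individuals are the constants of the signature, parameters for
  the free variables, and Henkin witnesses in countably many layers (domains grow along the
  accessibility relation); a world is a theory together with its domain.\<close>

datatype ('p, 'c) elem =
    Con 'c
  | Par nat
  | Wit nat "('p, ('p, 'c) elem) fm"

type_synonym ('p, 'c) world = "('p, ('p, 'c) elem) fm set \<times> ('p, 'c) elem set"

end

theory Submission
  imports Defs
begin

text \<open>Soundness is an induction on derivations. For completeness, \<open>\<rightarrow>\<close>, \<open>\<and>\<close>, \<open>\<or>\<close>, \<open>\<bottom>\<close> obey classical
  logic, so maximal consistent sets decide every sentence, and the axioms for strong negation push
  \<open>\<sim>\<close> inwards; falsification of \<open>\<Phi>\<close> is then membership of \<open>\<sim>\<Phi>\<close>. The canonical model has as worlds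
  the maximal consistent theories with witnesses over the languages of an increasing sequence of
  domains \<open>D\<^sub>0 \<subseteq> D\<^sub>1 \<subseteq> \<dots>\<close>. If \<open>\<Diamond>\<Phi>\<close> holds at a world with domain \<open>D\<^sub>n\<close>, then \<open>\<Phi>\<close> together with
  \<open>{\<Psi>. \<box>\<Psi> holds}\<close> is consistent and extends to a world with domain \<open>D\<^sub>n\<^sub>+\<^sub>1\<close>, where the new individual
  \<open>Wit n (\<exists>x. \<Psi>)\<close> is the witness for \<open>\<exists>x. \<Psi>\<close>. The free variables of \<open>\<Delta>\<close> are named by parameters,
  which are turned back into variables in a derivation by replacing constants by fresh variables.\<close>

section \<open>Substitution\<close>

text \<open>Increasing domains refute the Barcan formula, so the sentences forced at a successor may
  need witnesses that its predecessor lacks; this is why each step along the accessibility relation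
  opens a new layer. Witnesses are indexed by the formula they serve instead of being enumerated: no
  cardinality of the signature enters, and all worlds of one level share a domain. The price is that
  freshness is no longer a matter of bookkeeping; it comes from the level \<open>n\<close> with
  respect to the earlier layers, and from the size of the nested datatype within one layer. The
  other obstacle is capture. Substitution never renames bound variables, so a variable put in the
  place of a constant must avoid every variable quantified anywhere in the derivation. Parameters
  therefore cannot return directly to the variables they stand for: they return shifted beyond all
  of these, and the shift is undone inside the calculus.\<close>

fun bv :: "('p, 'c) fm \<Rightarrow> nat set" where
  "bv (Atom p ts) = {}"
| "bv Bot = {}"
| "bv (Imp \<Phi> \<Psi>) = bv \<Phi> \<union> bv \<Psi>"
| "bv (And \<Phi> \<Psi>) = bv \<Phi> \<union> bv \<Psi>"
| "bv (Or \<Phi> \<Psi>) = bv \<Phi> \<union> bv \<Psi>"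
| "bv (SNeg \<Phi>) = bv \<Phi>"
| "bv (Box \<Phi>) = bv \<Phi>"
| "bv (Dia \<Phi>) = bv \<Phi>"
| "bv (All x \<Phi>) = insert x (bv \<Phi>)"
| "bv (Ex x \<Phi>) = insert x (bv \<Phi>)"

lemma finite_bv [simp]: "finite (bv \<Phi>)"
  by (induction \<Phi>) auto

lemma finite_fv_trm [simp]: "finite (fv_trm t)"
  by (cases t) auto

lemma finite_fv [simp]: "finite (fv \<Phi>)"
  by (induction \<Phi>) auto

lemma subst_trm_cong: "(\<And>x. x \<in> fv_trm t \<Longrightarrow> s x = s' x) \<Longrightarrow> subst_trm s t = subst_trm s' t"
  by (cases t) auto

lemma subst_trm_Var [simp]: "subst_trm Var t = t"
  by (cases t) auto

lemma subst_cong: "(\<And>x. x \<in> fv \<Phi> \<Longrightarrow> s x = s' x) \<Longrightarrow> subst s \<Phi> = subst s' \<Phi>"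
proof (induction \<Phi> arbitrary: s s')
  case (Atom p ts)
  then show ?case by (auto intro!: subst_trm_cong)
next
  case (Imp \<Phi> \<Psi>)
  then show ?case by (metis Un_iff fv.simps(3) subst.simps(3))
next
  case (And \<Phi> \<Psi>)
  then show ?case by (metis Un_iff fv.simps(4) subst.simps(4))
next
  case (Or \<Phi> \<Psi>)
  then show ?case by (metis Un_iff fv.simps(5) subst.simps(5))
next
  case (All y \<Phi>)
  have "subst (s(y := Var y)) \<Phi> = subst (s'(y := Var y)) \<Phi>"
    by (rule All.IH) (use All.prems in auto)
  then show ?case by simp
next
  case (Ex y \<Phi>)
  have "subst (s(y := Var y)) \<Phi> = subst (s'(y := Var y)) \<Phi>"
    by (rule Ex.IH) (use Ex.prems in auto)
  then show ?case by simp
next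
  case (SNeg \<Phi>)
  then show ?case by (metis fv.simps(6) subst.simps(6))
next
  case (Box \<Phi>)
  then show ?case by (metis fv.simps(7) subst.simps(7))
next
  case (Dia \<Phi>)
  then show ?case by (metis fv.simps(8) subst.simps(8))
qed simp

lemma subst_Var [simp]: "subst Var \<Phi> = \<Phi>"
  by (induction \<Phi>) (auto intro: map_idI simp: fun_upd_idem)

lemma subst_closed: "fv \<Phi> = {} \<Longrightarrow> subst s \<Phi> = \<Phi>"
  using subst_cong[of \<Phi> s Var] by simp

lemma fv_subst_trm: "fv_trm (subst_trm s t) = (\<Union>x\<in>fv_trm t. fv_trm (s x))"
  by (cases t) auto

lemma fv_subst: "fv (subst s \<Phi>) \<subseteq> (\<Union>x\<in>fv \<Phi>. fv_trm (s x))"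
proof (induction \<Phi> arbitrary: s)
  case (All y \<Phi>)
  have "fv (subst (s(y := Var y)) \<Phi>) \<subseteq> (\<Union>x\<in>fv \<Phi>. fv_trm ((s(y := Var y)) x))"
    by (rule All.IH)
  then show ?case by (fastforce split: if_splits)
next
  case (Ex y \<Phi>)
  have "fv (subst (s(y := Var y)) \<Phi>) \<subseteq> (\<Union>x\<in>fv \<Phi>. fv_trm ((s(y := Var y)) x))"
    by (rule Ex.IH)
  then show ?case by (fastforce split: if_splits)
next
  case (Imp \<Phi> \<Psi>)
  show ?case using Imp.IH(1)[of s] Imp.IH(2)[of s] by auto
next
  case (And \<Phi> \<Psi>)
  show ?case using And.IH(1)[of s] And.IH(2)[of s] by auto
next
  case (Or \<Phi> \<Psi>)
  show ?case using Or.IH(1)[of s] Or.IH(2)[of s] by auto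
qed (simp_all add: fv_subst_trm)

text \<open>Capture is not excluded here, only made harmless. A variable \<open>b\<close> of
  \<open>s z\<close> that lands under a binder \<open>b\<close> is captured on both sides; on the
  left the binder protects it from \<open>s'\<close>, so the two sides agree as soon as
  \<open>s' b = Var b\<close>.\<close>

lemma subst_subst:
  assumes "\<And>b z. b \<in> bv \<Phi> \<Longrightarrow> z \<noteq> b \<Longrightarrow> b \<in> fv_trm (s z) \<Longrightarrow> s' b = Var b"
  shows "subst s' (subst s \<Phi>) = subst (\<lambda>z. subst_trm s' (s z)) \<Phi>"
proof -
  have upd: "(\<lambda>z. subst_trm (s'(b := Var b)) ((s(b := Var b)) z)) =
      (\<lambda>z. subst_trm s' (s z))(b := Var b)"
    if "\<And>z. z \<noteq> b \<Longrightarrow> b \<in> fv_trm (s z) \<Longrightarrow> s' b = Var b" for b and s s' :: "nat \<Rightarrow> 'b trm"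
  proof
    fix z
    show "subst_trm (s'(b := Var b)) ((s(b := Var b)) z) =
      ((\<lambda>z. subst_trm s' (s z))(b := Var b)) z"
      using that[of z] by (cases "z = b") (auto intro!: subst_trm_cong)
  qed
  show ?thesis
    using assms
  proof (induction \<Phi> arbitrary: s s')
    case (Atom p ts)
    have "subst_trm s' (subst_trm s t) = subst_trm (\<lambda>z. subst_trm s' (s z)) t" for t
      by (cases t) auto
    then show ?case by simp
  next
    case (All y \<Phi>)
    have "subst (s'(y := Var y)) (subst (s(y := Var y)) \<Phi>) =
        subst (\<lambda>z. subst_trm (s'(y := Var y)) ((s(y := Var y)) z)) \<Phi>"
    proof (rule All.IH)
      fix b z assume "b \<in> bv \<Phi>" "z \<noteq> b" "b \<in> fv_trm ((s(y := Var y)) z)"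
      then show "(s'(y := Var y)) b = Var b"
        using All.prems[of b z] by (auto split: if_splits)
    qed
    then show ?case using upd[of y s s'] All.prems[of y] by simp
  next
    case (Ex y \<Phi>)
    have "subst (s'(y := Var y)) (subst (s(y := Var y)) \<Phi>) =
        subst (\<lambda>z. subst_trm (s'(y := Var y)) ((s(y := Var y)) z)) \<Phi>"
    proof (rule Ex.IH)
      fix b z assume "b \<in> bv \<Phi>" "z \<noteq> b" "b \<in> fv_trm ((s(y := Var y)) z)"
      then show "(s'(y := Var y)) b = Var b"
        using Ex.prems[of b z] by (auto split: if_splits)
    qed
    then show ?case using upd[of y s s'] Ex.prems[of y] by simp
  qed simp_all
qed

lemma subst1_notin_fv: "x \<notin> fv \<Phi> \<Longrightarrow> subst1 x t \<Phi> = \<Phi>"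
  unfolding subst1_def by (subst subst_cong[of \<Phi> _ Var]) auto

text \<open>At a quantifier \<open>free_for\<close> leaves two cases: either \<open>x\<close> is not
  free there and nothing is substituted for it, or the bound variable does not occur in
  \<open>t\<close>, so that resetting \<open>l\<close> at this variable leaves
  \<open>subst_trm l t\<close> unchanged.\<close>

lemma subst_subst1:
  assumes "free_for t x \<Phi>"
  shows "subst l (subst1 x t \<Phi>) = subst (l(x := subst_trm l t)) \<Phi>"
  using assms
proof (induction \<Phi> arbitrary: l)
  case (Atom p ts)
  have "subst_trm l (subst_trm (Var(x := t)) u) = subst_trm (l(x := subst_trm l t)) u" for u
    by (cases u) auto
  then show ?case by (simp add: subst1_def del: fun_upd_apply)
next
  case (All y \<Phi>)
  show ?case
  proof (cases "x \<in> fv (All y \<Phi>)")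
    case False
    then show ?thesis
      unfolding subst1_notin_fv[OF False] by (intro subst_cong) auto
  next
    case True
    with All.prems have *: "x \<noteq> y" "y \<notin> fv_trm t" "free_for t x \<Phi>" by auto
    have "subst1 x t (All y \<Phi>) = All y (subst1 x t \<Phi>)"
      using *(1) by (auto simp: subst1_def fun_upd_idem)
    moreover have "subst_trm (l(y := Var y)) t = subst_trm l t"
      using *(2) by (auto intro!: subst_trm_cong)
    ultimately show ?thesis
      using All.IH[OF *(3), of "l(y := Var y)"] *(1)
      by (simp add: fun_upd_twist del: fun_upd_apply)
  qed
next
  case (Ex y \<Phi>)
  show ?case
  proof (cases "x \<in> fv (Ex y \<Phi>)")
    case False
    then show ?thesis
      unfolding subst1_notin_fv[OF False] by (intro subst_cong) auto
  next
    case True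
    with Ex.prems have *: "x \<noteq> y" "y \<notin> fv_trm t" "free_for t x \<Phi>" by auto
    have "subst1 x t (Ex y \<Phi>) = Ex y (subst1 x t \<Phi>)"
      using *(1) by (auto simp: subst1_def fun_upd_idem)
    moreover have "subst_trm (l(y := Var y)) t = subst_trm l t"
      using *(2) by (auto intro!: subst_trm_cong)
    ultimately show ?thesis
      using Ex.IH[OF *(3), of "l(y := Var y)"] *(1)
      by (simp add: fun_upd_twist del: fun_upd_apply)
  qed
qed (simp_all add: subst1_def)

text \<open>The semantic quantifier clauses insert a name after the outer substitution has passed
  the binder. Since the other values of \<open>l\<close> are closed, both steps merge into one
  updated substitution.\<close>

lemma subst1_subst_upd:
  assumes "\<And>z. z \<noteq> x \<Longrightarrow> fv_trm (l z) = {}"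
  shows "subst1 x t (subst (l(x := Var x)) \<Phi>) = subst (l(x := t)) \<Phi>"
proof -
  have "subst1 x t (subst (l(x := Var x)) \<Phi>) =
      subst (\<lambda>z. subst_trm (Var(x := t)) ((l(x := Var x)) z)) \<Phi>"
    unfolding subst1_def by (rule subst_subst) (use assms in \<open>auto split: if_splits\<close>)
  also have "\<dots> = subst (l(x := t)) \<Phi>"
  proof (rule subst_cong)
    fix z
    show "subst_trm (Var(x := t)) ((l(x := Var x)) z) = (l(x := t)) z"
      using assms[of z] by (cases "l z") auto
  qed
  finally show ?thesis .
qed

lemma wf_subst_trm: "wf_trm \<sigma> t \<Longrightarrow> (\<And>x. x \<in> fv_trm t \<Longrightarrow> wf_trm \<sigma> (s x)) \<Longrightarrow> wf_trm \<sigma> (subst_trm s t)"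
  by (cases t) auto

lemma wf_subst: "wf_fm \<sigma> \<Phi> \<Longrightarrow> (\<And>x. wf_trm \<sigma> (s x)) \<Longrightarrow> wf_fm \<sigma> (subst s \<Phi>)"
  by (induction \<Phi> arbitrary: s) (auto simp: wf_subst_trm)

lemma wf_subst1: "wf_fm \<sigma> \<Phi> \<Longrightarrow> wf_trm \<sigma> t \<Longrightarrow> wf_fm \<sigma> (subst1 x t \<Phi>)"
  unfolding subst1_def by (rule wf_subst) auto

lemma wf_subst_rev: "wf_fm \<sigma> (subst s \<Phi>) \<Longrightarrow> x \<in> fv \<Phi> \<Longrightarrow> wf_trm \<sigma> (s x)"
proof (induction \<Phi> arbitrary: s)
  case (Atom p ts)
  then obtain t where "t \<in> set ts" "x \<in> fv_trm t" by auto
  moreover from this(2) have "t = Var x" by (cases t) auto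
  ultimately show ?case using Atom.prems(1) by auto
next
  case (All y \<Phi>)
  then have "wf_trm \<sigma> ((s(y := Var y)) x)" by (intro All.IH) (auto simp del: fun_upd_apply)
  then show ?case using All.prems by (auto split: if_splits)
next
  case (Ex y \<Phi>)
  then have "wf_trm \<sigma> ((s(y := Var y)) x)" by (intro Ex.IH) (auto simp del: fun_upd_apply)
  then show ?case using Ex.prems by (auto split: if_splits)
qed auto

section \<open>Replacing constants by terms\<close>

fun repl_trm :: "('c \<Rightarrow> 'd trm) \<Rightarrow> 'c trm \<Rightarrow> 'd trm" where
  "repl_trm r (Var x) = Var x"
| "repl_trm r (Cst c) = r c"

text \<open>Like \<open>subst\<close>, this does not protect the variables of the new terms from capture.\<close>

fun repl :: "('c \<Rightarrow> 'd trm) \<Rightarrow> ('p, 'c) fm \<Rightarrow> ('p, 'd) fm" where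
  "repl r (Atom p ts) = Atom p (map (repl_trm r) ts)"
| "repl r Bot = Bot"
| "repl r (Imp \<Phi> \<Psi>) = Imp (repl r \<Phi>) (repl r \<Psi>)"
| "repl r (And \<Phi> \<Psi>) = And (repl r \<Phi>) (repl r \<Psi>)"
| "repl r (Or \<Phi> \<Psi>) = Or (repl r \<Phi>) (repl r \<Psi>)"
| "repl r (SNeg \<Phi>) = SNeg (repl r \<Phi>)"
| "repl r (Box \<Phi>) = Box (repl r \<Phi>)"
| "repl r (Dia \<Phi>) = Dia (repl r \<Phi>)"
| "repl r (All x \<Phi>) = All x (repl r \<Phi>)"
| "repl r (Ex x \<Phi>) = Ex x (repl r \<Phi>)"

lemma map_trm_eq_repl: "map_trm g t = repl_trm (\<lambda>c. Cst (g c)) t"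
  by (cases t) auto

lemma map_fm_eq_repl: "map_fm (\<lambda>p. p) g \<Phi> = repl (\<lambda>c. Cst (g c)) \<Phi>"
  by (induction \<Phi>) (auto simp: map_trm_eq_repl)

lemma repl_repl: "repl r (repl q \<Phi>) = repl (\<lambda>c. repl_trm r (q c)) \<Phi>"
proof (induction \<Phi>)
  case (Atom p ts)
  have "repl_trm r (repl_trm q t) = repl_trm (\<lambda>c. repl_trm r (q c)) t" for t by (cases t) auto
  then show ?case by simp
qed auto

lemma repl_id: "(\<And>c. c \<in> set2_fm \<Phi> \<Longrightarrow> r c = Cst c) \<Longrightarrow> repl r \<Phi> = \<Phi>"
proof (induction \<Phi>)
  case (Atom p ts)
  have "repl_trm r t = t" if t: "t \<in> set ts" for t
  proof (cases t)
    case (Cst c)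
    then have "c \<in> set2_fm (Atom p ts)" using t by force
    then show ?thesis using Cst Atom by simp
  qed simp
  then show ?case by (auto intro: map_idI)
qed auto

lemma fv_repl_trm: "fv_trm (repl_trm r t) \<subseteq> fv_trm t \<union> (\<Union>c. fv_trm (r c))"
  by (cases t) auto

lemma fv_repl: "fv (repl r \<Phi>) \<subseteq> fv \<Phi> \<union> (\<Union>c. fv_trm (r c))"
proof (induction \<Phi>)
  case (Atom p ts)
  then show ?case using fv_repl_trm by fastforce
qed auto

lemma fv_repl_closed: "(\<And>c. fv_trm (r c) = {}) \<Longrightarrow> fv (repl r \<Phi>) = fv \<Phi>"
proof (induction \<Phi>)
  case (Atom p ts)
  have "fv_trm (repl_trm r t) = fv_trm t" for t using Atom by (cases t) auto
  then show ?case by simp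
qed auto

text \<open>On the right the substitution also meets the terms that have replaced constants of
  \<open>\<Phi>\<close>; it leaves them intact because \<open>s\<close> fixes their
  variables.\<close>

lemma repl_subst:
  assumes "\<And>c x. c \<in> set2_fm \<Phi> \<Longrightarrow> x \<in> fv_trm (r c) \<Longrightarrow> s x = Var x"
  shows "repl r (subst s \<Phi>) = subst (\<lambda>x. repl_trm r (s x)) (repl r \<Phi>)"
  using assms
proof (induction \<Phi> arbitrary: s)
  case (Atom p ts)
  have "repl_trm r (subst_trm s t) = subst_trm (\<lambda>x. repl_trm r (s x)) (repl_trm r t)"
    if "t \<in> set ts" for t
  proof (cases t)
    case (Cst c)
    then have "c \<in> set2_fm (Atom p ts)" using that by force
    then have "subst_trm (\<lambda>x. repl_trm r (s x)) (r c) = subst_trm Var (r c)"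
      using Atom by (intro subst_trm_cong) auto
    then show ?thesis using Cst by simp
  qed simp
  then show ?case by simp
next
  case (All y \<Phi>)
  have "(\<lambda>x. repl_trm r ((s(y := Var y)) x)) = (\<lambda>x. repl_trm r (s x))(y := Var y)" by auto
  moreover have "repl r (subst (s(y := Var y)) \<Phi>) =
      subst (\<lambda>x. repl_trm r ((s(y := Var y)) x)) (repl r \<Phi>)"
    by (rule All.IH) (use All.prems in auto)
  ultimately show ?case by simp
next
  case (Ex y \<Phi>)
  have "(\<lambda>x. repl_trm r ((s(y := Var y)) x)) = (\<lambda>x. repl_trm r (s x))(y := Var y)" by auto
  moreover have "repl r (subst (s(y := Var y)) \<Phi>) =
      subst (\<lambda>x. repl_trm r ((s(y := Var y)) x)) (repl r \<Phi>)"
    by (rule Ex.IH) (use Ex.prems in auto)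
  ultimately show ?case by simp
next
  case (Imp \<Phi> \<Psi>)
  have "repl r (subst s \<Phi>) = subst (\<lambda>x. repl_trm r (s x)) (repl r \<Phi>)"
    by (rule Imp.IH) (use Imp.prems in auto)
  moreover have "repl r (subst s \<Psi>) = subst (\<lambda>x. repl_trm r (s x)) (repl r \<Psi>)"
    by (rule Imp.IH) (use Imp.prems in auto)
  ultimately show ?case by simp
next
  case (And \<Phi> \<Psi>)
  have "repl r (subst s \<Phi>) = subst (\<lambda>x. repl_trm r (s x)) (repl r \<Phi>)"
    by (rule And.IH) (use And.prems in auto)
  moreover have "repl r (subst s \<Psi>) = subst (\<lambda>x. repl_trm r (s x)) (repl r \<Psi>)"
    by (rule And.IH) (use And.prems in auto)
  ultimately show ?case by simp
next
  case (Or \<Phi> \<Psi>)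
  have "repl r (subst s \<Phi>) = subst (\<lambda>x. repl_trm r (s x)) (repl r \<Phi>)"
    by (rule Or.IH) (use Or.prems in auto)
  moreover have "repl r (subst s \<Psi>) = subst (\<lambda>x. repl_trm r (s x)) (repl r \<Psi>)"
    by (rule Or.IH) (use Or.prems in auto)
  ultimately show ?case by simp
qed simp_all

lemma repl_subst1:
  assumes "\<And>c. c \<in> set2_fm \<Phi> \<Longrightarrow> x \<notin> fv_trm (r c)"
  shows "repl r (subst1 x t \<Phi>) = subst1 x (repl_trm r t) (repl r \<Phi>)"
proof -
  have "(\<lambda>y. repl_trm r ((Var(x := t)) y)) = Var(x := repl_trm r t)" by auto
  moreover have "repl r (subst1 x t \<Phi>) =
      subst (\<lambda>y. repl_trm r ((Var(x := t)) y)) (repl r \<Phi>)"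
    unfolding subst1_def by (rule repl_subst) (use assms in auto)
  ultimately show ?thesis by (simp add: subst1_def)
qed

lemma free_for_repl:
  assumes "free_for t x \<Phi>" "\<And>c. fv_trm (r c) \<inter> insert x (bv \<Phi>) = {}"
  shows "free_for (repl_trm r t) x (repl r \<Phi>)"
  using assms
proof (induction \<Phi>)
  case (All y \<Phi>)
  have "fv_trm (r c) \<inter> insert x (bv \<Phi>) = {}" "y \<notin> fv_trm (r c)" "x \<notin> fv_trm (r c)" for c
    using All.prems(2)[of c] by auto
  then show ?case
    using All fv_repl[of r \<Phi>] fv_repl_trm[of r t] by auto
next
  case (Ex y \<Phi>)
  have "fv_trm (r c) \<inter> insert x (bv \<Phi>) = {}" "y \<notin> fv_trm (r c)" "x \<notin> fv_trm (r c)" for c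
    using Ex.prems(2)[of c] by auto
  then show ?case
    using Ex fv_repl[of r \<Phi>] fv_repl_trm[of r t] by auto
qed (auto simp: disjoint_iff)

lemma wf_repl:
  assumes "psyms \<tau> = psyms \<sigma>" "arity \<tau> = arity \<sigma>" "\<And>c. c \<in> csyms \<sigma> \<Longrightarrow> wf_trm \<tau> (r c)"
    and "wf_fm \<sigma> \<Phi>"
  shows "wf_fm \<tau> (repl r \<Phi>)"
  using assms(4)
proof (induction \<Phi>)
  case (Atom p ts)
  have "wf_trm \<sigma> t \<Longrightarrow> wf_trm \<tau> (repl_trm r t)" for t using assms(3) by (cases t) auto
  then show ?case using Atom assms(1,2) by auto
qed auto

lemma wf_set2_fm: "wf_fm \<sigma> \<Phi> \<Longrightarrow> set2_fm \<Phi> \<subseteq> csyms \<sigma>"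
proof (induction \<Phi>)
  case (Atom p ts)
  have "set_trm t \<subseteq> csyms \<sigma>" if "wf_trm \<sigma> t" for t using that by (cases t) auto
  then show ?case using Atom by force
qed auto

section \<open>Soundness\<close>

text \<open>Wider than \<open>ground_subst\<close>: instantiating a quantifier with a constant
  \<open>c\<close> of the signature leads to \<open>Cst (Inl c)\<close>, which is not the name of an
  individual and has to be compared with one.\<close>

definition val :: "('p, 'c) signature \<Rightarrow> 'a set \<Rightarrow> (nat \<Rightarrow> ('c + 'a) trm) \<Rightarrow> bool" where
  "val \<sigma> A l \<longleftrightarrow> (\<forall>x. l x \<in> Cst ` (Inl ` csyms \<sigma> \<union> Inr ` A))"

lemma ground_subst_val: "ground_subst A l \<Longrightarrow> val \<sigma> A l"
  unfolding ground_subst_def val_def by fast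

lemma val_upd: "val \<sigma> A l \<Longrightarrow> a \<in> A \<Longrightarrow> val \<sigma> A (l(x := name a))"
  unfolding val_def by auto

lemma val_mono:
  assumes "val \<sigma> A l" "A \<subseteq> B"
  shows "val \<sigma> B l"
proof -
  have "Cst ` (Inl ` csyms \<sigma> \<union> Inr ` A) \<subseteq> Cst ` (Inl ` csyms \<sigma> \<union> Inr ` B)"
    using assms(2) by auto
  then show ?thesis using assms(1) unfolding val_def by (meson subsetD)
qed

lemma val_closed: "val \<sigma> A l \<Longrightarrow> fv_trm (l x) = {}"
  unfolding val_def by (metis fv_trm.simps(2) imageE)

lemma ground_subst_upd: "ground_subst A l \<Longrightarrow> a \<in> A \<Longrightarrow> ground_subst A (l(x := name a))"
  unfolding ground_subst_def by auto

lemma ground_subst_mono: "ground_subst A l \<Longrightarrow> A \<subseteq> B \<Longrightarrow> ground_subst B l"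
  unfolding ground_subst_def by blast

lemma subst1_subst_val:
  "val \<sigma> A l \<Longrightarrow> subst1 x t (subst (l(x := Var x)) \<Phi>) = subst (l(x := t)) \<Phi>"
  by (rule subst1_subst_upd) (simp add: val_closed)

text \<open>Serves to exchange a constant for the name of its denotation. The atomic case needs that
  both structures of a world interpret constants equally, the modal cases that constants are rigid
  along the accessibility relation and that domains grow.\<close>

lemma verified_falsified_val_cong:
  assumes M: "QBK_model \<sigma> M"
    and "w \<in> worlds M" "val \<sigma> (domain (pos M w)) l" "val \<sigma> (domain (pos M w)) l'"
    and "\<And>x. tval (pos M w) (l x) = tval (pos M w) (l' x)"
  shows "(verified M w (subst l \<Phi>) \<longleftrightarrow> verified M w (subst l' \<Phi>)) \<and>
         (falsified M w (subst l \<Phi>) \<longleftrightarrow> falsified M w (subst l' \<Phi>))"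
  using assms(2-)
proof (induction \<Phi> arbitrary: w l l')
  case (Atom p ts)
  have neg: "tval (neg M w) (l x) = tval (pos M w) (l x)" if "val \<sigma> (domain (pos M w)) l" for l x
  proof -
    have "l x \<in> Cst ` (Inl ` csyms \<sigma> \<union> Inr ` domain (pos M w))" using that by (auto simp: val_def)
    then show ?thesis using M Atom.prems(1) by (auto simp: QBK_model_def)
  qed
  have 1: "tval (pos M w) (subst_trm l t) = tval (pos M w) (subst_trm l' t)" for t
    using Atom.prems(4) by (cases t) auto
  have 2: "tval (neg M w) (subst_trm l t) = tval (neg M w) (subst_trm l' t)" for t
    using Atom.prems neg by (cases t) auto
  from 1 2 show ?case by (simp add: sat_atom_def comp_def)
next
  case (Box \<Phi>)
  have "(verified M v (subst l \<Phi>) \<longleftrightarrow> verified M v (subst l' \<Phi>)) \<and>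
         (falsified M v (subst l \<Phi>) \<longleftrightarrow> falsified M v (subst l' \<Phi>))" if "(w, v) \<in> acc M" for v
  proof (rule Box.IH)
    have sub: "domain (pos M w) \<subseteq> domain (pos M v)"
      and c: "\<And>c. c \<in> csyms \<sigma> \<Longrightarrow> cint (pos M w) c = cint (pos M v) c"
      using M that by (auto simp: QBK_model_def)
    show "v \<in> worlds M" using M that by (auto simp: QBK_model_def)
    show "val \<sigma> (domain (pos M v)) l" "val \<sigma> (domain (pos M v)) l'"
      using Box.prems sub val_mono by blast+
    fix x
    have "tval (pos M v) (l x) = tval (pos M w) (l x)" if "val \<sigma> (domain (pos M w)) l" for l
    proof -
      have "l x \<in> Cst ` (Inl ` csyms \<sigma> \<union> Inr ` domain (pos M w))" using that by (auto simp: val_def)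
      then show ?thesis using c by auto
    qed
    then show "tval (pos M v) (l x) = tval (pos M v) (l' x)" using Box.prems by simp
  qed
  then show ?case by auto
next
  case (Dia \<Phi>)
  have "(verified M v (subst l \<Phi>) \<longleftrightarrow> verified M v (subst l' \<Phi>)) \<and>
         (falsified M v (subst l \<Phi>) \<longleftrightarrow> falsified M v (subst l' \<Phi>))" if "(w, v) \<in> acc M" for v
  proof (rule Dia.IH)
    have sub: "domain (pos M w) \<subseteq> domain (pos M v)"
      and c: "\<And>c. c \<in> csyms \<sigma> \<Longrightarrow> cint (pos M w) c = cint (pos M v) c"
      using M that by (auto simp: QBK_model_def)
    show "v \<in> worlds M" using M that by (auto simp: QBK_model_def)
    show "val \<sigma> (domain (pos M v)) l" "val \<sigma> (domain (pos M v)) l'"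
      using Dia.prems sub val_mono by blast+
    fix x
    have "tval (pos M v) (l x) = tval (pos M w) (l x)" if "val \<sigma> (domain (pos M w)) l" for l
    proof -
      have "l x \<in> Cst ` (Inl ` csyms \<sigma> \<union> Inr ` domain (pos M w))" using that by (auto simp: val_def)
      then show ?thesis using c by auto
    qed
    then show "tval (pos M v) (l x) = tval (pos M v) (l' x)" using Dia.prems by simp
  qed
  then show ?case by auto
next
  case (All x \<Phi>)
  have "(verified M w (subst (l(x := name a)) \<Phi>) \<longleftrightarrow> verified M w (subst (l'(x := name a)) \<Phi>)) \<and>
       (falsified M w (subst (l(x := name a)) \<Phi>) \<longleftrightarrow> falsified M w (subst (l'(x := name a)) \<Phi>))"
    if "a \<in> domain (pos M w)" for a
    by (rule All.IH[OF All.prems(1) val_upd[OF All.prems(2) that] val_upd[OF All.prems(3) that]])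
      (use All.prems(4) in auto)
  then show ?case using All.prems by (auto simp: subst1_subst_val)
next
  case (Ex x \<Phi>)
  have "(verified M w (subst (l(x := name a)) \<Phi>) \<longleftrightarrow> verified M w (subst (l'(x := name a)) \<Phi>)) \<and>
       (falsified M w (subst (l(x := name a)) \<Phi>) \<longleftrightarrow> falsified M w (subst (l'(x := name a)) \<Phi>))"
    if "a \<in> domain (pos M w)" for a
    by (rule Ex.IH[OF Ex.prems(1) val_upd[OF Ex.prems(2) that] val_upd[OF Ex.prems(3) that]])
      (use Ex.prems(4) in auto)
  then show ?case using Ex.prems by (auto simp: subst1_subst_val)
next
  case (Imp \<Phi> \<Psi>)
  show ?case using Imp.IH(1)[OF Imp.prems] Imp.IH(2)[OF Imp.prems] by simp
next
  case (And \<Phi> \<Psi>)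
  show ?case using And.IH(1)[OF And.prems] And.IH(2)[OF And.prems] by simp
next
  case (Or \<Phi> \<Psi>)
  show ?case using Or.IH(1)[OF Or.prems] Or.IH(2)[OF Or.prems] by simp
next
  case (SNeg \<Phi>)
  show ?case using SNeg.IH[OF SNeg.prems] by simp
qed simp

text \<open>The model condition concerns atoms only, but the two clauses of each connective clash as
  soon as they clash for some immediate subformula, at a successor or instance if need be.\<close>

lemma not_verified_and_falsified:
  assumes M: "QB3K_model \<sigma> M"
    and "w \<in> worlds M" "ground_subst (domain (pos M w)) l" "wf_fm \<sigma> \<Phi>"
  shows "\<not> (verified M w (subst l (lift_fm \<Phi>)) \<and> falsified M w (subst l (lift_fm \<Phi>)))"
  using assms(2-)
proof (induction \<Phi> arbitrary: w l)
  case (Atom p ts)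
  let ?ts = "map (\<lambda>t. subst_trm l (map_trm Inl t)) ts"
  have "fv_trm (subst_trm l (map_trm Inl t)) = {} \<and>
      wf_trm (expand \<sigma> (domain (pos M w))) (subst_trm l (map_trm Inl t))"
    if t: "t \<in> set ts" for t
  proof (cases t)
    case (Var x)
    obtain a where "a \<in> domain (pos M w)" "l x = name a"
      using Atom.prems by (auto simp: ground_subst_def)
    then show ?thesis using Var by (simp add: expand_def)
  next
    case (Cst c)
    then show ?thesis using Atom.prems t by (auto simp: expand_def)
  qed
  \<comment> \<open>The model condition speaks only of atomic sentences over the domain of
    \<open>w\<close>; groundness of \<open>l\<close> turns the instance into one.\<close>
  then have "Atom p ?ts \<in> Sent (expand \<sigma> (domain (pos M w)))"
    using Atom.prems by (auto simp: Sent_def Form_def expand_def)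
  then show ?case using M Atom.prems(1) by (fastforce simp: QB3K_model_def comp_def)
next
  case (Box \<Phi>)
  have "v \<in> worlds M \<and> domain (pos M w) \<subseteq> domain (pos M v)" if "(w, v) \<in> acc M" for v
    using M that by (auto simp: QBK_model_def QB3K_model_def)
  then have "\<not> (verified M v (subst l (lift_fm \<Phi>)) \<and> falsified M v (subst l (lift_fm \<Phi>)))"
    if "(w, v) \<in> acc M" for v
    using Box.prems that by (intro Box.IH) (auto intro: ground_subst_mono)
  then show ?case by auto
next
  case (Dia \<Phi>)
  have "v \<in> worlds M \<and> domain (pos M w) \<subseteq> domain (pos M v)" if "(w, v) \<in> acc M" for v
    using M that by (auto simp: QBK_model_def QB3K_model_def)
  then have "\<not> (verified M v (subst l (lift_fm \<Phi>)) \<and> falsified M v (subst l (lift_fm \<Phi>)))"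
    if "(w, v) \<in> acc M" for v
    using Dia.prems that by (intro Dia.IH) (auto intro: ground_subst_mono)
  then show ?case by auto
next
  case (All x \<Phi>)
  then have "\<not> (verified M w (subst (l(x := name a)) (lift_fm \<Phi>)) \<and>
      falsified M w (subst (l(x := name a)) (lift_fm \<Phi>)))" if "a \<in> domain (pos M w)" for a
    using that by (intro All.IH ground_subst_upd) auto
  then show ?case
    by (auto simp: subst1_subst_val[OF ground_subst_val[OF All.prems(2)]])
next
  case (Ex x \<Phi>)
  then have "\<not> (verified M w (subst (l(x := name a)) (lift_fm \<Phi>)) \<and>
      falsified M w (subst (l(x := name a)) (lift_fm \<Phi>)))" if "a \<in> domain (pos M w)" for a
    using that by (intro Ex.IH ground_subst_upd) auto
  then show ?case
    by (auto simp: subst1_subst_val[OF ground_subst_val[OF Ex.prems(2)]])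
next
  case (Imp \<Phi> \<Psi>)
  then show ?case using Imp.IH(1)[OF Imp.prems(1,2)] Imp.IH(2)[OF Imp.prems(1,2)] by auto
next
  case (And \<Phi> \<Psi>)
  then show ?case using And.IH(1)[OF And.prems(1,2)] And.IH(2)[OF And.prems(1,2)] by auto
next
  case (Or \<Phi> \<Psi>)
  then show ?case using Or.IH(1)[OF Or.prems(1,2)] Or.IH(2)[OF Or.prems(1,2)] by auto
next
  case (SNeg \<Phi>)
  then show ?case using SNeg.IH[OF SNeg.prems(1,2)] by auto
qed simp

section \<open>Validity of the axioms and rules\<close>

lemma lift_subst1: "lift_fm (subst1 x t \<Phi>) = subst1 x (map_trm Inl t) (lift_fm \<Phi>)"
  by (simp add: map_fm_eq_repl map_trm_eq_repl repl_subst1)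

lemma fv_lift [simp]: "fv (lift_fm \<Phi>) = fv \<Phi>"
  by (simp add: map_fm_eq_repl fv_repl_closed)

lemma free_for_lift: "free_for t x \<Phi> \<Longrightarrow> free_for (map_trm Inl t) x (lift_fm \<Phi>)"
  by (simp add: map_fm_eq_repl map_trm_eq_repl free_for_repl)

lemma verified_instance:
  assumes M: "QBK_model \<sigma> M" "w \<in> worlds M" "ground_subst (domain (pos M w)) l"
    and "free_for t x \<Phi>" "wf_fm \<sigma> (subst1 x t \<Phi>)"
  obtains a where "a \<in> domain (pos M w)"
    "verified M w (subst l (lift_fm (subst1 x t \<Phi>))) \<longleftrightarrow>
     verified M w (subst (l(x := name a)) (lift_fm \<Phi>))"
proof -
  have str: "is_struct \<sigma> (pos M w)" using M by (auto simp: QBK_model_def)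
  have eq: "subst l (lift_fm (subst1 x t \<Phi>)) =
      subst (l(x := subst_trm l (map_trm Inl t))) (lift_fm \<Phi>)"
    using assms(4) by (simp add: lift_subst1 subst_subst1 free_for_lift)
  \<comment> \<open>If \<open>x\<close> is not free, \<open>t\<close> disappears from the instance
    and may be a constant outside the signature, whose value need not lie in the domain. Then any
    element serves, and the domain is non-empty.\<close>
  consider "x \<notin> fv \<Phi>" | y where "t = Var y" | c where "t = Cst c" "x \<in> fv \<Phi>"
    by (cases t) auto
  then show ?thesis
  proof cases
    case 1
    obtain a where "a \<in> domain (pos M w)" using str by (auto simp: is_struct_def)
    moreover have "subst l (lift_fm \<Phi>) = subst (l(x := name a)) (lift_fm \<Phi>)"
      by (rule subst_cong) (use 1 in auto)
    ultimately show ?thesis using 1 that by (simp add: subst1_notin_fv)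
  next
    case 2
    obtain a where "a \<in> domain (pos M w)" "l y = name a"
      using assms(3) by (auto simp: ground_subst_def)
    then show ?thesis using that eq 2 by simp
  next
    case (3 c)
    have c: "c \<in> csyms \<sigma>"
      using wf_subst_rev[of \<sigma> "Var(x := t)" \<Phi> x] 3 assms(5) by (simp add: subst1_def)
    let ?a = "cint (pos M w) c"
    have a: "?a \<in> domain (pos M w)" using str c by (auto simp: is_struct_def)
    have "val \<sigma> (domain (pos M w)) (l(x := Cst (Inl c)))"
      using ground_subst_val[OF assms(3), of \<sigma>] c by (auto simp: val_def)
    then have "verified M w (subst (l(x := Cst (Inl c))) (lift_fm \<Phi>)) \<longleftrightarrow>
        verified M w (subst (l(x := name ?a)) (lift_fm \<Phi>))"
      by (intro verified_falsified_val_cong[OF M(1,2), THEN conjunct1]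
          val_upd[OF ground_subst_val[OF assms(3)] a]) auto
    then show ?thesis using that[OF a] eq 3 by simp
  qed
qed

lemma verified_All_subst:
  assumes "ground_subst (domain (pos M w)) l"
  shows "verified M w (subst l (All x \<Phi>)) \<longleftrightarrow>
    (\<forall>a\<in>domain (pos M w). verified M w (subst (l(x := name a)) \<Phi>))"
  by (simp add: subst1_subst_val[OF ground_subst_val[OF assms]])

lemma verified_Ex_subst:
  assumes "ground_subst (domain (pos M w)) l"
  shows "verified M w (subst l (Ex x \<Phi>)) \<longleftrightarrow>
    (\<exists>a\<in>domain (pos M w). verified M w (subst (l(x := name a)) \<Phi>))"
  by (simp add: subst1_subst_val[OF ground_subst_val[OF assms]])

lemma axioms_sound:
  assumes "\<Phi> \<in> QB3K_axioms" "wf_fm \<sigma> \<Phi>"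
    and M: "QB3K_model \<sigma> M" "w \<in> worlds M" "ground_subst (domain (pos M w)) l"
  shows "verified M w (subst l (lift_fm \<Phi>))"
  using assms(1,2)
proof cases
  case (22 t x \<Phi>')
  obtain a where "a \<in> domain (pos M w)"
    "verified M w (subst l (lift_fm (subst1 x t \<Phi>'))) \<longleftrightarrow>
     verified M w (subst (l(x := name a)) (lift_fm \<Phi>'))"
    using verified_instance[of \<sigma> M w l t x \<Phi>'] M 22 assms(2) by (auto simp: QB3K_model_def)
  then show ?thesis using 22 verified_All_subst[OF M(3)] by (auto simp del: subst.simps(9))
next
  case (23 t x \<Phi>')
  obtain a where "a \<in> domain (pos M w)"
    "verified M w (subst l (lift_fm (subst1 x t \<Phi>'))) \<longleftrightarrow>
     verified M w (subst (l(x := name a)) (lift_fm \<Phi>'))"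
    using verified_instance[of \<sigma> M w l t x \<Phi>'] M 23 assms(2) by (auto simp: QB3K_model_def)
  then show ?thesis using 23 verified_Ex_subst[OF M(3)] by (auto simp del: subst.simps(10))
next
  case (26 \<Phi>' \<Psi>')
  then show ?thesis using not_verified_and_falsified[OF M, of \<Phi>'] assms(2) by auto
qed (simp_all add: subst1_def, (blast+)?)

lemma QB3K_wf: "\<Phi> \<in> QB3K \<sigma> \<Longrightarrow> wf_fm \<sigma> \<Phi>"
  by (induction rule: QB3K.induct) (auto simp: Form_def)

lemma verified_BR1:
  assumes "x \<notin> fv \<Phi>" "ground_subst (domain (pos M w)) l"
    and "\<And>l. ground_subst (domain (pos M w)) l \<Longrightarrow> verified M w (subst l (lift_fm (Imp \<Phi> \<Psi>)))"
  shows "verified M w (subst l (lift_fm (Imp \<Phi> (All x \<Psi>))))"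
proof -
  have "verified M w (subst (l(x := name a)) (lift_fm \<Psi>))"
    if "a \<in> domain (pos M w)" "verified M w (subst l (lift_fm \<Phi>))" for a
  proof -
    have "subst (l(x := name a)) (lift_fm \<Phi>) = subst l (lift_fm \<Phi>)"
      by (rule subst_cong) (use assms(1) in auto)
    then show ?thesis using assms(3)[OF ground_subst_upd[OF assms(2) that(1)], of x] that by simp
  qed
  then show ?thesis using verified_All_subst[OF assms(2)] by (auto simp del: subst.simps(9))
qed

lemma verified_BR2:
  assumes "x \<notin> fv \<Psi>" "ground_subst (domain (pos M w)) l"
    and "\<And>l. ground_subst (domain (pos M w)) l \<Longrightarrow> verified M w (subst l (lift_fm (Imp \<Phi> \<Psi>)))"
  shows "verified M w (subst l (lift_fm (Imp (Ex x \<Phi>) \<Psi>)))"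
proof -
  have "verified M w (subst l (lift_fm \<Psi>))"
    if "a \<in> domain (pos M w)" "verified M w (subst (l(x := name a)) (lift_fm \<Phi>))" for a
  proof -
    have "subst (l(x := name a)) (lift_fm \<Psi>) = subst l (lift_fm \<Psi>)"
      by (rule subst_cong) (use assms(1) in auto)
    then show ?thesis using assms(3)[OF ground_subst_upd[OF assms(2) that(1)], of x] that by simp
  qed
  then show ?thesis using verified_Ex_subst[OF assms(2)] by (auto simp del: subst.simps(10))
qed

text \<open>World and substitution vary together in the induction: \<open>MB\<close> and
  \<open>MD\<close> pass to a successor, where the larger domain keeps \<open>l\<close> ground, and
  \<open>BR1\<close>, \<open>BR2\<close> change \<open>l\<close> at the bound variable.\<close>

lemma QB3K_sound:
  assumes "\<Phi> \<in> QB3K \<sigma>" and M: "QB3K_model \<sigma> M"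
    and "w \<in> worlds M" "ground_subst (domain (pos M w)) l"
  shows "verified M w (subst l (lift_fm \<Phi>))"
proof -
  have acc: "v \<in> worlds M" "domain (pos M w) \<subseteq> domain (pos M v)" if "(w, v) \<in> acc M" for w v
    using M that by (auto simp: QBK_model_def QB3K_model_def)
  show ?thesis
    using assms(1,3,4)
  proof (induction arbitrary: w l rule: QB3K.induct)
    case (Ax \<Phi>)
    then show ?case using axioms_sound M by (auto simp: Form_def)
  next
    case (MP \<Phi> \<Psi>)
    then show ?case by fastforce
  next
    case (MB \<Phi> \<Psi>)
    have "verified M v (subst l (lift_fm (Imp \<Phi> \<Psi>)))" if "(w, v) \<in> acc M" for v
      by (rule MB.IH[OF acc(1)[OF that] ground_subst_mono[OF MB.prems(2) acc(2)[OF that]]])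
    then show ?case by auto
  next
    case (MD \<Phi> \<Psi>)
    have "verified M v (subst l (lift_fm (Imp \<Phi> \<Psi>)))" if "(w, v) \<in> acc M" for v
      by (rule MD.IH[OF acc(1)[OF that] ground_subst_mono[OF MD.prems(2) acc(2)[OF that]]])
    then show ?case by auto
  next
    case (BR1 \<Phi> \<Psi> x)
    then show ?case by (intro verified_BR1) auto
  next
    case (BR2 \<Phi> \<Psi> x)
    then show ?case by (intro verified_BR2) auto
  qed
qed

text \<open>Here the world stays fixed, because \<open>MB\<close> and \<open>MD\<close> do not apply
  to consequences of hypotheses. The substitution must vary for \<open>BR1\<close> and
  \<open>BR2\<close>, which does not affect the hypotheses since they are sentences.\<close>

lemma obtainable_sound:
  assumes "\<Phi> \<in> obtainable (\<Gamma> \<union> QB3K \<sigma>)" and \<Gamma>: "\<Gamma> \<subseteq> Sent \<sigma>"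
    and M: "QB3K_model \<sigma> M" "w \<in> worlds M" "\<And>\<Phi>. \<Phi> \<in> \<Gamma> \<Longrightarrow> verified M w (lift_fm \<Phi>)"
    and "ground_subst (domain (pos M w)) l"
  shows "verified M w (subst l (lift_fm \<Phi>))"
  using assms(1,6)
proof (induction arbitrary: l rule: obtainable.induct)
  case (Hyp \<Phi>)
  show ?case
  proof (cases "\<Phi> \<in> \<Gamma>")
    case True
    then have "fv (lift_fm \<Phi>) = {}" using \<Gamma> by (auto simp: Sent_def)
    then show ?thesis using M(3)[OF True] by (simp add: subst_closed)
  next
    case False
    then have "\<Phi> \<in> QB3K \<sigma>" using Hyp by blast
    then show ?thesis by (rule QB3K_sound[OF _ M(1,2) Hyp.prems])
  qed
next
  case (MP \<Phi> \<Psi>)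
  then show ?case by fastforce
next
  case (BR1 \<Phi> \<Psi> x)
  then show ?case by (intro verified_BR1) auto
next
  case (BR2 \<Phi> \<Psi> x)
  then show ?case by (intro verified_BR2) auto
qed

lemma verified_disj:
  "verified M w (subst l (lift_fm (disj \<Phi>s))) \<longleftrightarrow> (\<exists>\<Phi>\<in>set \<Phi>s. verified M w (subst l (lift_fm \<Phi>)))"
  by (induction \<Phi>s rule: disj.induct) auto

lemma soundness:
  fixes \<sigma> :: "('p, 'c) signature" and \<Gamma> \<Delta> :: "('p, 'c) fm set"
  assumes "\<Gamma> \<subseteq> Sent \<sigma>" "QB3K_derives \<sigma> \<Gamma> \<Delta>"
  shows "QB3K_entails TYPE('w) TYPE('a) \<sigma> \<Gamma> \<Delta>"
proof -
  obtain \<Phi>s where \<Phi>s: "set \<Phi>s \<subseteq> \<Delta>" "disj \<Phi>s \<in> obtainable (\<Gamma> \<union> QB3K \<sigma>)"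
    using assms(2) by (auto simp: QB3K_derives_def Disj_def)
  show ?thesis
    unfolding QB3K_entails_def
  proof (intro allI impI)
    fix M :: "('p, 'c, 'w, 'a) model" and w
      and l :: "nat \<Rightarrow> ('c + 'a) trm"
    assume "QB3K_model \<sigma> M" "w \<in> worlds M" "ground_subst (domain (pos M w)) l"
      "\<forall>\<Phi>\<in>\<Gamma>. verified M w (lift_fm \<Phi>)"
    then have "verified M w (subst l (lift_fm (disj \<Phi>s)))"
      by (intro obtainable_sound[OF \<Phi>s(2) assms(1)]) auto
    then show "\<exists>\<Psi>\<in>\<Delta>. verified M w (subst l (lift_fm \<Psi>))"
      using \<Phi>s(1) by (auto simp: verified_disj)
  qed
qed

section \<open>Derivations from hypotheses\<close>

text \<open>With modus ponens as the only rule, the deduction theorem needs no condition on free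
  variables. For hypotheses that are sentences \<open>BR1\<close> and \<open>BR2\<close> are
  recovered as admissible rules.\<close>

inductive_set der :: "('p, 'c) signature \<Rightarrow> ('p, 'c) fm set \<Rightarrow> ('p, 'c) fm set" for \<sigma> T where
  hyp: "\<Phi> \<in> T \<Longrightarrow> \<Phi> \<in> der \<sigma> T"
| th: "\<Phi> \<in> QB3K \<sigma> \<Longrightarrow> \<Phi> \<in> der \<sigma> T"
| mp: "\<Phi> \<in> der \<sigma> T \<Longrightarrow> Imp \<Phi> \<Psi> \<in> der \<sigma> T \<Longrightarrow> \<Psi> \<in> der \<sigma> T"

lemma der_wf: "\<Phi> \<in> der \<sigma> T \<Longrightarrow> T \<subseteq> Form \<sigma> \<Longrightarrow> wf_fm \<sigma> \<Phi>"
  by (induction rule: der.induct) (auto simp: Form_def QB3K_wf)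

lemma der_mono: "\<Phi> \<in> der \<sigma> T \<Longrightarrow> T \<subseteq> T' \<Longrightarrow> \<Phi> \<in> der \<sigma> T'"
  by (induction rule: der.induct) (auto intro: der.intros)

lemma der_empty: "\<Phi> \<in> der \<sigma> {} \<Longrightarrow> \<Phi> \<in> QB3K \<sigma>"
  by (induction rule: der.induct) (auto intro: QB3K.MP)

lemma der_finite: "\<Phi> \<in> der \<sigma> T \<Longrightarrow> \<exists>F. finite F \<and> F \<subseteq> T \<and> \<Phi> \<in> der \<sigma> F"
proof (induction rule: der.induct)
  case (hyp \<Phi>)
  then show ?case by (intro exI[of _ "{\<Phi>}"]) (auto intro: der.hyp)
next
  case (th \<Phi>)
  then show ?case by (intro exI[of _ "{}"]) (auto intro: der.th)
next
  case (mp \<Phi> \<Psi>)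
  then obtain F F' where "finite F" "F \<subseteq> T" "\<Phi> \<in> der \<sigma> F" "finite F'" "F' \<subseteq> T" "Imp \<Phi> \<Psi> \<in> der \<sigma> F'"
    by blast
  moreover from this have "\<Psi> \<in> der \<sigma> (F \<union> F')" by (meson der.mp der_mono sup_ge1 sup_ge2)
  ultimately show ?case by (intro exI[of _ "F \<union> F'"]) auto
qed

lemma der_ax: "\<Phi> \<in> QB3K_axioms \<Longrightarrow> wf_fm \<sigma> \<Phi> \<Longrightarrow> \<Phi> \<in> der \<sigma> T"
  by (auto intro!: der.th QB3K.Ax simp: Form_def)

lemma der_K: "\<Psi> \<in> der \<sigma> T \<Longrightarrow> wf_fm \<sigma> \<Phi> \<Longrightarrow> wf_fm \<sigma> \<Psi> \<Longrightarrow> Imp \<Phi> \<Psi> \<in> der \<sigma> T"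
  by (rule der.mp[OF _ der_ax[OF QB3K_axioms.intros(1)]]) auto

lemma der_refl: "wf_fm \<sigma> \<Phi> \<Longrightarrow> Imp \<Phi> \<Phi> \<in> der \<sigma> T"
  by (rule der.mp[OF _ der.mp[OF _ der_ax[OF QB3K_axioms.intros(2)[of \<Phi> "Imp \<Phi> \<Phi>" \<Phi>]]]])
    (auto intro!: der_ax QB3K_axioms.intros(1))

lemma der_deduct:
  assumes "\<Psi> \<in> der \<sigma> (insert \<Phi> T)" "wf_fm \<sigma> \<Phi>" "T \<subseteq> Form \<sigma>"
  shows "Imp \<Phi> \<Psi> \<in> der \<sigma> T"
  using assms(1)
proof (induction rule: der.induct)
  case (hyp \<Psi>)
  show ?case
  proof (cases "\<Psi> = \<Phi>")
    case False
    then have "\<Psi> \<in> T" using hyp by auto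
    then show ?thesis using assms(2,3) by (intro der_K der.hyp) (auto simp: Form_def)
  qed (simp add: assms(2) der_refl)
next
  case (th \<Psi>)
  then show ?case using assms(2) by (intro der_K der.th) (auto simp: QB3K_wf)
next
  case (mp \<Psi> \<Theta>)
  have "wf_fm \<sigma> (Imp \<Psi> \<Theta>)" using mp.hyps(2) by (rule der_wf) (use assms in \<open>auto simp: Form_def\<close>)
  then have "Imp (Imp \<Phi> (Imp \<Psi> \<Theta>)) (Imp (Imp \<Phi> \<Psi>) (Imp \<Phi> \<Theta>)) \<in> der \<sigma> T"
    using assms(2) by (intro der_ax QB3K_axioms.intros) auto
  then show ?case using mp.IH by (blast intro: der.mp)
qed

lemma der_imp_iff:
  assumes "wf_fm \<sigma> \<Phi>" "T \<subseteq> Form \<sigma>"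
  shows "Imp \<Phi> \<Psi> \<in> der \<sigma> T \<longleftrightarrow> \<Psi> \<in> der \<sigma> (insert \<Phi> T)"
proof
  assume "Imp \<Phi> \<Psi> \<in> der \<sigma> T"
  then show "\<Psi> \<in> der \<sigma> (insert \<Phi> T)"
    by (meson der.hyp der.mp der_mono insertI1 subset_insertI)
qed (rule der_deduct[OF _ assms])

lemma der_efq: "Bot \<in> der \<sigma> T \<Longrightarrow> wf_fm \<sigma> \<Phi> \<Longrightarrow> \<Phi> \<in> der \<sigma> T"
  by (rule der.mp[OF _ der_ax[OF QB3K_axioms.intros(10)]]) auto

lemma der_conjE:
  assumes "And \<Phi> \<Psi> \<in> der \<sigma> T" "wf_fm \<sigma> \<Phi>" "wf_fm \<sigma> \<Psi>"
  shows "\<Phi> \<in> der \<sigma> T" "\<Psi> \<in> der \<sigma> T"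
  using der.mp[OF assms(1) der_ax[OF QB3K_axioms.intros(3)]]
    der.mp[OF assms(1) der_ax[OF QB3K_axioms.intros(4)]] assms by auto

lemma der_conjI:
  assumes "\<Phi> \<in> der \<sigma> T" "\<Psi> \<in> der \<sigma> T" "wf_fm \<sigma> \<Phi>" "wf_fm \<sigma> \<Psi>"
  shows "And \<Phi> \<Psi> \<in> der \<sigma> T"
  using der.mp[OF assms(2) der.mp[OF assms(1) der_ax[OF QB3K_axioms.intros(5)]]] assms by auto

lemma der_disjI:
  assumes "\<Phi> \<in> der \<sigma> T \<or> \<Psi> \<in> der \<sigma> T" "wf_fm \<sigma> \<Phi>" "wf_fm \<sigma> \<Psi>"
  shows "Or \<Phi> \<Psi> \<in> der \<sigma> T"
  using der.mp[OF _ der_ax[OF QB3K_axioms.intros(6)], of \<Phi> \<sigma> T \<Psi>]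
    der.mp[OF _ der_ax[OF QB3K_axioms.intros(7)], of \<Psi> \<sigma> T \<Phi>] assms by auto

lemma der_disjE:
  assumes "Or \<Phi> \<Psi> \<in> der \<sigma> T" "Imp \<Phi> \<Theta> \<in> der \<sigma> T" "Imp \<Psi> \<Theta> \<in> der \<sigma> T"
    "wf_fm \<sigma> \<Phi>" "wf_fm \<sigma> \<Psi>" "wf_fm \<sigma> \<Theta>"
  shows "\<Theta> \<in> der \<sigma> T"
  using der.mp[OF assms(1) der.mp[OF assms(3) der.mp[OF assms(2) der_ax[OF QB3K_axioms.intros(8)]]]]
    assms by auto

lemma der_ccontr:
  assumes "Bot \<in> der \<sigma> (insert (Neg \<Phi>) T)" "wf_fm \<sigma> \<Phi>" "T \<subseteq> Form \<sigma>"
  shows "\<Phi> \<in> der \<sigma> T"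
proof (rule der_disjE)
  show "Or \<Phi> (Neg \<Phi>) \<in> der \<sigma> T" using assms by (intro der_ax QB3K_axioms.intros) auto
  show "Imp \<Phi> \<Phi> \<in> der \<sigma> T" using assms by (simp add: der_refl)
  show "Imp (Neg \<Phi>) \<Phi> \<in> der \<sigma> T" using assms by (intro der_deduct[OF der_efq]) auto
qed (use assms in auto)

text \<open>The finitely many hypotheses in use move into the succedent by the deduction theorem;
  being sentences they do not disturb the side condition on \<open>x\<close>, and without hypotheses
  the rule belongs to the calculus.\<close>

lemma der_BR2:
  assumes "Imp \<Phi> \<Psi> \<in> der \<sigma> T" "T \<subseteq> Sent \<sigma>" "x \<notin> fv \<Psi>"
  shows "Imp (Ex x \<Phi>) \<Psi> \<in> der \<sigma> T"
proof -
  obtain F where "finite F" and F: "F \<subseteq> Sent \<sigma>" "Imp \<Phi> \<Psi> \<in> der \<sigma> F" "F \<subseteq> T"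
    using der_finite[OF assms(1)] assms(2) by blast
  from this(1-3) assms(3) have "Imp (Ex x \<Phi>) \<Psi> \<in> der \<sigma> F"
  proof (induction F arbitrary: \<Psi> rule: finite_induct)
    case empty
    then show ?case by (auto dest!: der_empty intro: der.th QB3K.BR2)
  next
    case (insert \<theta> F)
    have F: "F \<subseteq> Form \<sigma>" "wf_fm \<sigma> \<theta>" "fv \<theta> = {}" and IF: "insert \<theta> F \<subseteq> Form \<sigma>"
      using insert.prems by (auto simp: Sent_def Form_def)
    have wf: "wf_fm \<sigma> \<Phi>" "wf_fm \<sigma> \<Psi>" using der_wf[OF insert.prems(2) IF] by auto
    have "Imp \<Phi> (Imp \<theta> \<Psi>) \<in> der \<sigma> F"
      using insert.prems(2) F wf by (simp add: der_imp_iff Form_def insert_commute)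
    then have "Imp (Ex x \<Phi>) (Imp \<theta> \<Psi>) \<in> der \<sigma> F"
      using insert.prems F by (intro insert.IH) auto
    then show ?case
      using F wf by (simp add: der_imp_iff Form_def insert_commute)
  qed
  then show ?thesis using F(3) by (rule der_mono)
qed

lemma der_BR1:
  assumes "Imp \<Phi> \<Psi> \<in> der \<sigma> T" "T \<subseteq> Sent \<sigma>" "x \<notin> fv \<Phi>"
  shows "Imp \<Phi> (All x \<Psi>) \<in> der \<sigma> T"
proof -
  obtain F where "finite F" and F: "F \<subseteq> Sent \<sigma>" "Imp \<Phi> \<Psi> \<in> der \<sigma> F" "F \<subseteq> T"
    using der_finite[OF assms(1)] assms(2) by blast
  from this(1-3) assms(3) have "Imp \<Phi> (All x \<Psi>) \<in> der \<sigma> F"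
  proof (induction F arbitrary: \<Phi> rule: finite_induct)
    case empty
    then show ?case by (auto dest!: der_empty intro: der.th QB3K.BR1)
  next
    case (insert \<theta> F)
    have F: "F \<subseteq> Form \<sigma>" "wf_fm \<sigma> \<theta>" "fv \<theta> = {}" and IF: "insert \<theta> F \<subseteq> Form \<sigma>"
      using insert.prems by (auto simp: Sent_def Form_def)
    have wf: "wf_fm \<sigma> \<Phi>" "wf_fm \<sigma> \<Psi>" using der_wf[OF insert.prems(2) IF] by auto
    \<comment> \<open>For \<open>BR1\<close> the formula to be quantified is the succedent, so the
      hypothesis is moved into the antecedent, by a conjunction.\<close>
    let ?A = "And \<theta> \<Phi>"
    have A: "\<theta> \<in> der \<sigma> (insert ?A F)" "\<Phi> \<in> der \<sigma> (insert ?A F)"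
      using F wf by (auto intro: der.hyp der_conjE[of \<theta> \<Phi>])
    have "Imp \<theta> (Imp \<Phi> \<Psi>) \<in> der \<sigma> (insert ?A F)"
      using insert.prems(2) F(1,2) by (intro der_mono[OF der_deduct[OF insert.prems(2)]]) auto
    then have "\<Psi> \<in> der \<sigma> (insert ?A F)" using A by (blast intro: der.mp)
    then have "Imp ?A \<Psi> \<in> der \<sigma> F" using F wf by (intro der_deduct) auto
    then have "Imp ?A (All x \<Psi>) \<in> der \<sigma> F"
      using insert.prems F by (intro insert.IH) auto
    then have "Imp ?A (All x \<Psi>) \<in> der \<sigma> (insert \<Phi> (insert \<theta> F))"
      by (rule der_mono) auto
    moreover have "?A \<in> der \<sigma> (insert \<Phi> (insert \<theta> F))"
      using F wf by (intro der_conjI der.hyp) auto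
    ultimately show ?case using IF wf by (intro der_deduct) (blast intro: der.mp)+
  qed
  then show ?thesis using F(3) by (rule der_mono)
qed

lemma der_subst1:
  assumes "\<Theta> \<in> der \<sigma> T" "T \<subseteq> Sent \<sigma>" "free_for t x \<Theta>" "wf_trm \<sigma> t"
  shows "subst1 x t \<Theta> \<in> der \<sigma> T"
proof -
  have wf: "wf_fm \<sigma> \<Theta>" using assms der_wf by (fastforce simp: Sent_def)
  \<comment> \<open>Generalisation is available only for implications; a provable closed antecedent
    turns \<open>BR1\<close> into the rule that derives \<open>All x \<Theta>\<close> from
    \<open>\<Theta>\<close>.\<close>
  have "Imp (Imp Bot Bot) \<Theta> \<in> der \<sigma> T" using assms(1) wf by (intro der_K) auto
  then have "Imp (Imp Bot Bot) (All x \<Theta>) \<in> der \<sigma> T" using assms(2) by (rule der_BR1) simp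
  moreover have "Imp Bot Bot \<in> der \<sigma> T" by (rule der_refl) simp
  ultimately have "All x \<Theta> \<in> der \<sigma> T" by (blast intro: der.mp)
  then show ?thesis
    by (rule der.mp) (use wf assms in \<open>auto intro!: der_ax QB3K_axioms.intros(22) wf_subst1\<close>)
qed

text \<open>The quantifier duality axioms concern \<open>SNeg\<close>; for \<open>Neg\<close> the
  law is obtained by classical reasoning. It lets witnesses for existential sentences settle
  universal ones as well.\<close>

lemma der_not_All_imp_Ex_not:
  assumes "wf_fm \<sigma> \<Phi>"
  shows "Imp (Neg (All x \<Phi>)) (Ex x (Neg \<Phi>)) \<in> der \<sigma> {}"
proof -
  let ?E = "Ex x (Neg \<Phi>)"
  have free: "free_for (Var x) x \<Phi>" by (induction \<Phi>) auto
  have "Imp (subst1 x (Var x) (Neg \<Phi>)) ?E \<in> der \<sigma> {}"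
    using assms free by (intro der_ax QB3K_axioms.intros) (auto intro!: wf_subst1)
  then have 1: "Imp (Neg \<Phi>) ?E \<in> der \<sigma> {}" by (simp add: subst1_def)
  have wfE: "wf_fm \<sigma> ?E" using assms by simp
  have "\<Phi> \<in> der \<sigma> {Neg ?E}"
  proof (rule der_ccontr)
    have "?E \<in> der \<sigma> (insert (Neg \<Phi>) {Neg ?E})"
      by (rule der.mp[OF der.hyp der_mono[OF 1]]) auto
    then show "Bot \<in> der \<sigma> (insert (Neg \<Phi>) {Neg ?E})"
      by (rule der.mp) (auto intro: der.hyp)
  qed (use assms in \<open>auto simp: Form_def\<close>)
  then have "Imp (Neg ?E) \<Phi> \<in> der \<sigma> {}" using wfE by (intro der_deduct) auto
  then have "Imp (Neg ?E) (All x \<Phi>) \<in> der \<sigma> {}" by (rule der_BR1) auto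
  then have 2: "Imp (Neg ?E) (All x \<Phi>) \<in> der \<sigma> {Neg ?E, Neg (All x \<Phi>)}" by (rule der_mono) auto
  have "?E \<in> der \<sigma> {Neg (All x \<Phi>)}"
  proof (rule der_ccontr)
    have "All x \<Phi> \<in> der \<sigma> {Neg ?E, Neg (All x \<Phi>)}"
      by (rule der.mp[OF der.hyp 2]) auto
    then show "Bot \<in> der \<sigma> (insert (Neg ?E) {Neg (All x \<Phi>)})"
      by (rule der.mp) (auto intro: der.hyp)
  qed (use assms in \<open>auto simp: Form_def\<close>)
  then show ?thesis using assms by (intro der_deduct) auto
qed

lemma der_Box:
  assumes "\<Psi> \<in> der \<sigma> X" "X \<subseteq> Form \<sigma>"
  shows "Box \<Psi> \<in> der \<sigma> (Box ` X)"
  using assms(1)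
proof (induction rule: der.induct)
  case (hyp \<Phi>)
  then show ?case by (auto intro: der.hyp)
next
  case (th \<Phi>)
  then have wf: "wf_fm \<sigma> \<Phi>" by (rule QB3K_wf)
  \<comment> \<open>There is no rule of necessitation: \<open>Box \<Phi>\<close> is reached from the
    axiom \<open>Box (Imp \<Phi> \<Phi>)\<close> by \<open>MB\<close>.\<close>
  have "Imp (Imp \<Phi> \<Phi>) \<Phi> \<in> QB3K \<sigma>"
    by (rule der_empty, rule der_K, rule der.th) (use th wf in auto)
  then have "Imp (Box (Imp \<Phi> \<Phi>)) (Box \<Phi>) \<in> der \<sigma> (Box ` X)" by (intro der.th QB3K.MB)
  moreover have "Box (Imp \<Phi> \<Phi>) \<in> der \<sigma> (Box ` X)"
    using wf by (intro der_ax QB3K_axioms.intros) auto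
  ultimately show ?case by (blast intro: der.mp)
next
  case (mp \<Phi> \<Psi>)
  then have wf: "wf_fm \<sigma> \<Phi>" "wf_fm \<sigma> \<Psi>" using der_wf[OF mp.hyps(2) assms(2)] by auto
  \<comment> \<open>Distribution of \<open>Box\<close> over \<open>Imp\<close> is not an axiom; it
    is obtained by applying \<open>MB\<close> to modus ponens written as one implication from a
    conjunction.\<close>
  let ?A = "And \<Phi> (Imp \<Phi> \<Psi>)"
  have "\<Phi> \<in> der \<sigma> {?A}" "Imp \<Phi> \<Psi> \<in> der \<sigma> {?A}"
    using wf by (auto intro: der.hyp der_conjE[of \<Phi> "Imp \<Phi> \<Psi>"])
  then have "\<Psi> \<in> der \<sigma> {?A}" by (rule der.mp)
  then have "Imp ?A \<Psi> \<in> QB3K \<sigma>" using wf by (intro der_empty der_deduct) auto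
  then have 1: "Imp (Box ?A) (Box \<Psi>) \<in> der \<sigma> (Box ` X)" by (intro der.th QB3K.MB)
  have "And (Box \<Phi>) (Box (Imp \<Phi> \<Psi>)) \<in> der \<sigma> (Box ` X)"
    using mp.IH wf by (intro der_conjI) auto
  moreover have "Imp (And (Box \<Phi>) (Box (Imp \<Phi> \<Psi>))) (Box ?A) \<in> der \<sigma> (Box ` X)"
    using wf by (intro der_ax QB3K_axioms.intros) auto
  ultimately show ?case using 1 by (blast intro: der.mp)
qed

lemma der_obtainable: "\<Phi> \<in> der \<sigma> T \<Longrightarrow> \<Phi> \<in> obtainable (T \<union> QB3K \<sigma>)"
  by (induction rule: der.induct) (auto intro: obtainable.intros)

section \<open>Replacing constants in derivations\<close>

text \<open>\<open>V\<close> collects the variables that are quantified somewhere in the derivation; as long as the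
  new terms avoid them, replacing constants by terms preserves every axiom and every rule.\<close>

lemma axioms_repl:
  fixes \<Phi> :: "('p, 'c) fm"
  assumes "\<Phi> \<in> QB3K_axioms"
  shows "\<exists>V. finite V \<and>
    (\<forall>r :: 'c \<Rightarrow> 'd trm. (\<forall>c. fv_trm (r c) \<inter> V = {}) \<longrightarrow> repl r \<Phi> \<in> QB3K_axioms)"
  using assms
proof cases
  case (22 t x \<Psi>)
  have "repl r \<Phi> \<in> QB3K_axioms"
    if "\<forall>c. fv_trm (r c) \<inter> insert x (bv \<Psi>) = {}" for r :: "'c \<Rightarrow> 'd trm"
    using 22 that by (auto intro!: QB3K_axioms.intros(22) free_for_repl simp: repl_subst1)
  then show ?thesis by (intro exI[of _ "insert x (bv \<Psi>)"]) auto
next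
  case (23 t x \<Psi>)
  have "repl r \<Phi> \<in> QB3K_axioms"
    if "\<forall>c. fv_trm (r c) \<inter> insert x (bv \<Psi>) = {}" for r :: "'c \<Rightarrow> 'd trm"
    using 23 that by (auto intro!: QB3K_axioms.intros(23) free_for_repl simp: repl_subst1)
  then show ?thesis by (intro exI[of _ "insert x (bv \<Psi>)"]) auto
qed (intro exI[of _ "{}"], simp add: QB3K_axioms.intros)+

lemma QB3K_repl:
  fixes \<sigma> :: "('p, 'c) signature" and \<tau> :: "('p, 'd) signature"
  assumes sig: "psyms \<tau> = psyms \<sigma>" "arity \<tau> = arity \<sigma>" and "\<Phi> \<in> QB3K \<sigma>"
  shows "\<exists>V. finite V \<and> (\<forall>r. (\<forall>c. fv_trm (r c) \<inter> V = {}) \<longrightarrow>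
    (\<forall>c\<in>csyms \<sigma>. wf_trm \<tau> (r c)) \<longrightarrow> repl r \<Phi> \<in> QB3K \<tau>)"
  using assms(3)
proof (induction rule: QB3K.induct)
  case (Ax \<Phi>)
  obtain V where "finite V"
    "\<forall>r :: 'c \<Rightarrow> 'd trm. (\<forall>c. fv_trm (r c) \<inter> V = {}) \<longrightarrow> repl r \<Phi> \<in> QB3K_axioms"
    using axioms_repl[OF Ax(1)] by blast
  then show ?case
    using Ax(2) wf_repl[OF sig] by (intro exI[of _ V]) (auto intro!: QB3K.Ax simp: Form_def)
next
  case (MP \<Phi> \<Psi>)
  then obtain V V' where V: "finite V" "finite V'"
    "\<And>r. (\<forall>c. fv_trm (r c) \<inter> V = {}) \<Longrightarrow> (\<forall>c\<in>csyms \<sigma>. wf_trm \<tau> (r c)) \<Longrightarrow> repl r \<Phi> \<in> QB3K \<tau>"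
    "\<And>r. (\<forall>c. fv_trm (r c) \<inter> V' = {}) \<Longrightarrow> (\<forall>c\<in>csyms \<sigma>. wf_trm \<tau> (r c)) \<Longrightarrow> repl r (Imp \<Phi> \<Psi>) \<in> QB3K \<tau>"
    by metis
  have "repl r \<Psi> \<in> QB3K \<tau>"
    if "\<forall>c. fv_trm (r c) \<inter> (V \<union> V') = {}" "\<forall>c\<in>csyms \<sigma>. wf_trm \<tau> (r c)" for r
    using V(3)[of r] V(4)[of r] that by (auto simp: Int_Un_distrib intro: QB3K.MP)
  then show ?case using V(1,2) by (intro exI[of _ "V \<union> V'"]) blast
next
  case (MB \<Phi> \<Psi>)
  then obtain V where "finite V" "\<forall>r. (\<forall>c. fv_trm (r c) \<inter> V = {}) \<longrightarrow>
      (\<forall>c\<in>csyms \<sigma>. wf_trm \<tau> (r c)) \<longrightarrow> repl r (Imp \<Phi> \<Psi>) \<in> QB3K \<tau>" by metis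
  then show ?case by (intro exI[of _ V]) (auto intro: QB3K.MB)
next
  case (MD \<Phi> \<Psi>)
  then obtain V where "finite V" "\<forall>r. (\<forall>c. fv_trm (r c) \<inter> V = {}) \<longrightarrow>
      (\<forall>c\<in>csyms \<sigma>. wf_trm \<tau> (r c)) \<longrightarrow> repl r (Imp \<Phi> \<Psi>) \<in> QB3K \<tau>" by metis
  then show ?case by (intro exI[of _ V]) (auto intro: QB3K.MD)
next
  case (BR1 \<Phi> \<Psi> x)
  then obtain V where V: "finite V"
    "\<And>r. (\<forall>c. fv_trm (r c) \<inter> V = {}) \<Longrightarrow> (\<forall>c\<in>csyms \<sigma>. wf_trm \<tau> (r c)) \<Longrightarrow> repl r (Imp \<Phi> \<Psi>) \<in> QB3K \<tau>"
    by metis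
  have "repl r (Imp \<Phi> (All x \<Psi>)) \<in> QB3K \<tau>"
    if r: "\<forall>c. fv_trm (r c) \<inter> insert x V = {}" "\<forall>c\<in>csyms \<sigma>. wf_trm \<tau> (r c)" for r
  proof -
    have "x \<notin> fv (repl r \<Phi>)" using fv_repl[of r \<Phi>] BR1(2) r by auto
    then show ?thesis using V(2)[of r] r by (auto intro: QB3K.BR1)
  qed
  then show ?case using V(1) by (intro exI[of _ "insert x V"]) blast
next
  case (BR2 \<Phi> \<Psi> x)
  then obtain V where V: "finite V"
    "\<And>r. (\<forall>c. fv_trm (r c) \<inter> V = {}) \<Longrightarrow> (\<forall>c\<in>csyms \<sigma>. wf_trm \<tau> (r c)) \<Longrightarrow> repl r (Imp \<Phi> \<Psi>) \<in> QB3K \<tau>"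
    by metis
  have "repl r (Imp (Ex x \<Phi>) \<Psi>) \<in> QB3K \<tau>"
    if r: "\<forall>c. fv_trm (r c) \<inter> insert x V = {}" "\<forall>c\<in>csyms \<sigma>. wf_trm \<tau> (r c)" for r
  proof -
    have "x \<notin> fv (repl r \<Psi>)" using fv_repl[of r \<Psi>] BR2(2) r by auto
    then show ?thesis using V(2)[of r] r by (auto intro: QB3K.BR2)
  qed
  then show ?case using V(1) by (intro exI[of _ "insert x V"]) blast
qed

text \<open>\<open>V\<close> depends on the derivation alone and is obtained before
  \<open>r\<close>, so a caller can first pick a variable outside \<open>V\<close> and then build
  \<open>r\<close> from it.\<close>

lemma der_repl:
  fixes \<sigma> :: "('p, 'c) signature" and \<tau> :: "('p, 'd) signature"
  assumes sig: "psyms \<tau> = psyms \<sigma>" "arity \<tau> = arity \<sigma>" and "\<Phi> \<in> der \<sigma> T"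
  obtains V where "finite V"
    "\<And>r. (\<And>c. fv_trm (r c) \<inter> V = {}) \<Longrightarrow> (\<And>c. c \<in> csyms \<sigma> \<Longrightarrow> wf_trm \<tau> (r c)) \<Longrightarrow>
      repl r \<Phi> \<in> der \<tau> (repl r ` T)"
proof -
  have "\<exists>V. finite V \<and> (\<forall>r. (\<forall>c. fv_trm (r c) \<inter> V = {}) \<longrightarrow>
    (\<forall>c\<in>csyms \<sigma>. wf_trm \<tau> (r c)) \<longrightarrow> repl r \<Phi> \<in> der \<tau> (repl r ` T))"
    using assms(3)
  proof (induction rule: der.induct)
    case (hyp \<Phi>)
    then show ?case by (intro exI[of _ "{}"]) (auto intro: der.hyp)
  next
    case (th \<Phi>)
    then show ?case using QB3K_repl[OF sig th] by (meson der.th)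
  next
    case (mp \<Phi> \<Psi>)
    then obtain V V' where V: "finite V" "finite V'"
      "\<And>r. (\<forall>c. fv_trm (r c) \<inter> V = {}) \<Longrightarrow> (\<forall>c\<in>csyms \<sigma>. wf_trm \<tau> (r c)) \<Longrightarrow>
        repl r \<Phi> \<in> der \<tau> (repl r ` T)"
      "\<And>r. (\<forall>c. fv_trm (r c) \<inter> V' = {}) \<Longrightarrow> (\<forall>c\<in>csyms \<sigma>. wf_trm \<tau> (r c)) \<Longrightarrow>
        repl r (Imp \<Phi> \<Psi>) \<in> der \<tau> (repl r ` T)"
      by metis
    have "repl r \<Psi> \<in> der \<tau> (repl r ` T)"
      if "\<forall>c. fv_trm (r c) \<inter> (V \<union> V') = {}" "\<forall>c\<in>csyms \<sigma>. wf_trm \<tau> (r c)" for r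
      using V(3)[of r] V(4)[of r] that by (auto simp: Int_Un_distrib intro: der.mp)
    then show ?case using V(1,2) by (intro exI[of _ "V \<union> V'"]) blast
  qed
  then obtain V where "finite V" and V: "\<forall>r. (\<forall>c. fv_trm (r c) \<inter> V = {}) \<longrightarrow>
    (\<forall>c\<in>csyms \<sigma>. wf_trm \<tau> (r c)) \<longrightarrow> repl r \<Phi> \<in> der \<tau> (repl r ` T)"
    by (elim exE conjE)
  show ?thesis by (rule that[OF \<open>finite V\<close>]) (simp add: V)
qed

section \<open>Renaming a bound variable and removing a Henkin axiom\<close>

lemma free_for_Var_notin_bv: "y \<notin> bv \<Phi> \<Longrightarrow> free_for (Var y) x \<Phi>"
  by (induction \<Phi>) auto

text \<open>Every free \<open>y\<close> of the result stands where \<open>\<Phi>\<close> has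
  \<open>x\<close> free, hence outside the scope of any binder \<open>x\<close>. This makes it
  possible to substitute \<open>x\<close> back for \<open>y\<close>.\<close>

lemma free_for_Var_subst:
  assumes "y \<notin> bv \<Phi>" "\<And>z. z \<in> fv \<Phi> \<Longrightarrow> y \<in> fv_trm (s z) \<Longrightarrow> z = x"
  shows "free_for (Var x) y (subst s \<Phi>)"
  using assms
proof (induction \<Phi> arbitrary: s)
  case (All b \<Phi>)
  show ?case
  proof (cases "b = x")
    case True
    then show ?thesis using All.prems fv_subst[of "s(b := Var b)" \<Phi>] by (fastforce split: if_splits)
  next
    case False
    have "free_for (Var x) y (subst (s(b := Var b)) \<Phi>)"
      by (rule All.IH) (use All.prems in \<open>auto split: if_splits\<close>)
    then show ?thesis using False by simp
  qed
next
  case (Ex b \<Phi>)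
  show ?case
  proof (cases "b = x")
    case True
    then show ?thesis using Ex.prems fv_subst[of "s(b := Var b)" \<Phi>] by (fastforce split: if_splits)
  next
    case False
    have "free_for (Var x) y (subst (s(b := Var b)) \<Phi>)"
      by (rule Ex.IH) (use Ex.prems in \<open>auto split: if_splits\<close>)
    then show ?thesis using False by simp
  qed
next
  case (Imp \<Phi> \<Psi>)
  have "free_for (Var x) y (subst s \<Phi>)" by (rule Imp.IH) (use Imp.prems in auto)
  moreover have "free_for (Var x) y (subst s \<Psi>)" by (rule Imp.IH) (use Imp.prems in auto)
  ultimately show ?case by simp
next
  case (And \<Phi> \<Psi>)
  have "free_for (Var x) y (subst s \<Phi>)" by (rule And.IH) (use And.prems in auto)
  moreover have "free_for (Var x) y (subst s \<Psi>)" by (rule And.IH) (use And.prems in auto)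
  ultimately show ?case by simp
next
  case (Or \<Phi> \<Psi>)
  have "free_for (Var x) y (subst s \<Phi>)" by (rule Or.IH) (use Or.prems in auto)
  moreover have "free_for (Var x) y (subst s \<Psi>)" by (rule Or.IH) (use Or.prems in auto)
  ultimately show ?case by simp
qed simp_all

text \<open>Substituting back recovers \<open>\<Phi>\<close>, so \<open>\<Phi>\<close> is itself an
  instance of the renamed body; the instantiation axiom for \<open>Ex y\<close> and then
  \<open>BR2\<close> for \<open>x\<close> apply.\<close>

lemma der_Ex_rename:
  assumes "wf_fm \<sigma> \<Phi>" "y \<notin> bv \<Phi> \<union> fv \<Phi>" "y \<noteq> x"
  shows "Imp (Ex x \<Phi>) (Ex y (subst1 x (Var y) \<Phi>)) \<in> der \<sigma> {}"
proof -
  have eq: "subst1 y (Var x) (subst1 x (Var y) \<Phi>) = \<Phi>"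
  proof -
    have "subst1 y (Var x) (subst1 x (Var y) \<Phi>) =
        subst ((Var(y := Var x))(x := Var x)) \<Phi>"
      using subst_subst1[OF free_for_Var_notin_bv, of y \<Phi> "Var(y := Var x)" x] assms
      by (simp add: subst1_def[of y] del: fun_upd_apply) simp
    also have "\<dots> = subst Var \<Phi>" by (rule subst_cong) (use assms in auto)
    finally show ?thesis by simp
  qed
  have free: "free_for (Var x) y (subst1 x (Var y) \<Phi>)"
    unfolding subst1_def by (rule free_for_Var_subst) (use assms in \<open>auto split: if_splits\<close>)
  have "Imp \<Phi> (Ex y (subst1 x (Var y) \<Phi>)) \<in> der \<sigma> {}"
    using der_ax[OF QB3K_axioms.intros(23)[OF free], of \<sigma> "{}"] assms(1) wf_subst1[OF assms(1)]
    by (auto simp: eq)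
  moreover have "x \<notin> fv (Ex y (subst1 x (Var y) \<Phi>))"
    using fv_subst[of "Var(x := Var y)" \<Phi>] assms by (auto simp: subst1_def split: if_splits)
  ultimately show ?thesis by (intro der_BR2) auto
qed

text \<open>With \<open>e\<close> turned into a fresh variable \<open>y\<close>, an inconsistency
  makes \<open>T\<close> derive both \<open>Ex x \<Phi>\<close> and the negation of the instance at
  \<open>y\<close>. \<open>BR2\<close> turns the latter into a negated \<open>Ex y\<close>, and
  renaming the bound variable yields the contradiction.\<close>

lemma der_Henkin_axiom:
  assumes "Bot \<in> der \<sigma> (insert (Imp (Ex x \<Phi>) (subst1 x (Cst e) \<Phi>)) T)"
    and "T \<subseteq> Sent \<sigma>" "Ex x \<Phi> \<in> Sent \<sigma>" "e \<in> csyms \<sigma>"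
    and e: "e \<notin> set2_fm \<Phi>" "\<And>\<Psi>. \<Psi> \<in> T \<Longrightarrow> e \<notin> set2_fm \<Psi>"
  shows "Bot \<in> der \<sigma> T"
proof -
  let ?H = "Imp (Ex x \<Phi>) (subst1 x (Cst e) \<Phi>)"
  have wf: "wf_fm \<sigma> \<Phi>" "T \<subseteq> Form \<sigma>" using assms by (auto simp: Sent_def Form_def)
  obtain V where V: "finite V"
    "\<And>r. (\<And>c. fv_trm (r c) \<inter> V = {}) \<Longrightarrow> (\<And>c. c \<in> csyms \<sigma> \<Longrightarrow> wf_trm \<sigma> (r c)) \<Longrightarrow>
      repl r Bot \<in> der \<sigma> (repl r ` insert ?H T)"
    by (rule der_repl[OF refl refl assms(1)]) iprover
  \<comment> \<open>Avoiding \<open>V\<close> keeps the derivation valid under the replacement;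
    \<open>x\<close> and the variables of \<open>\<Phi>\<close> are avoided for the substitution and
    the renaming.\<close>
  have "finite (insert x (V \<union> bv \<Phi> \<union> fv \<Phi>))" using V(1) by simp
  then obtain y where y: "y \<notin> insert x (V \<union> bv \<Phi> \<union> fv \<Phi>)"
    using ex_new_if_finite[OF infinite_UNIV_nat] by metis
  let ?r = "Cst(e := Var y)"
  have "repl ?r Bot \<in> der \<sigma> (repl ?r ` insert ?H T)"
    by (rule V(2)) (use y in \<open>auto split: if_splits\<close>)
  moreover have "repl ?r ` T = T"
  proof -
    have "repl ?r \<Psi> = \<Psi>" if "\<Psi> \<in> T" for \<Psi> using e(2)[OF that] by (intro repl_id) auto
    then show ?thesis by force
  qed
  moreover have "repl ?r \<Phi> = \<Phi>" using e(1) by (intro repl_id) auto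
  moreover have "repl ?r (subst1 x (Cst e) \<Phi>) = subst1 x (Var y) (repl ?r \<Phi>)"
    by (subst repl_subst1) (use y in auto)
  ultimately have 1: "Bot \<in> der \<sigma> (insert (Imp (Ex x \<Phi>) (subst1 x (Var y) \<Phi>)) T)" by simp
  let ?\<Phi>y = "subst1 x (Var y) \<Phi>"
  have wfy: "wf_fm \<sigma> ?\<Phi>y" using wf by (auto intro: wf_subst1)
  have neg: "Neg (Imp (Ex x \<Phi>) ?\<Phi>y) \<in> der \<sigma> T"
    using 1 wf wfy by (intro der_deduct) auto
  have Ex: "Ex x \<Phi> \<in> der \<sigma> T"
  proof (rule der_ccontr)
    let ?T = "insert (Neg (Ex x \<Phi>)) T"
    have "Bot \<in> der \<sigma> (insert (Ex x \<Phi>) ?T)"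
      by (rule der.mp[of "Ex x \<Phi>"]) (auto intro: der.hyp)
    then have "Imp (Ex x \<Phi>) ?\<Phi>y \<in> der \<sigma> ?T"
      using wf wfy by (intro der_deduct[OF der_efq]) (auto simp: Form_def)
    then show "Bot \<in> der \<sigma> ?T" using der_mono[OF neg, of ?T] by (blast intro: der.mp)
  qed (use wf in auto)
  have "Neg ?\<Phi>y \<in> der \<sigma> T"
  proof (rule der_deduct)
    let ?T = "insert ?\<Phi>y T"
    have "Imp (Ex x \<Phi>) ?\<Phi>y \<in> der \<sigma> ?T"
      using wf wfy by (intro der_K der.hyp) auto
    then show "Bot \<in> der \<sigma> ?T" using der_mono[OF neg, of ?T] by (blast intro: der.mp)
  qed (use wf wfy in auto)
  then have "Neg (Ex y ?\<Phi>y) \<in> der \<sigma> T" using assms(2) by (rule der_BR2) simp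
  moreover have "Imp (Ex x \<Phi>) (Ex y ?\<Phi>y) \<in> der \<sigma> T"
    by (rule der_mono[OF der_Ex_rename]) (use wf y in auto)
  ultimately show ?thesis using Ex by (blast intro: der.mp)
qed

section \<open>Maximal consistent sets\<close>

lemma Sent_iff: "\<Phi> \<in> Sent \<sigma> \<longleftrightarrow> wf_fm \<sigma> \<Phi> \<and> fv \<Phi> = {}"
  by (auto simp: Sent_def Form_def)

lemma Sent_Form: "T \<subseteq> Sent \<sigma> \<Longrightarrow> T \<subseteq> Form \<sigma>"
  by (auto simp: Sent_def)

definition mcs :: "('p, 'c) signature \<Rightarrow> ('p, 'c) fm set \<Rightarrow> bool" where
  "mcs \<sigma> T \<longleftrightarrow> T \<subseteq> Sent \<sigma> \<and> Bot \<notin> der \<sigma> T \<and> (\<forall>\<Phi>\<in>Sent \<sigma>. \<Phi> \<in> T \<or> Neg \<Phi> \<in> T)"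

text \<open>Zorn's lemma replaces an enumeration of sentences because the signature may be
  uncountable. Unions of chains stay consistent since a derivation uses finitely many
  hypotheses.\<close>

lemma Lindenbaum:
  assumes "S \<subseteq> Sent \<sigma>" "Bot \<notin> der \<sigma> S"
  obtains T where "S \<subseteq> T" "mcs \<sigma> T"
proof -
  let ?A = "{T. S \<subseteq> T \<and> T \<subseteq> Sent \<sigma> \<and> Bot \<notin> der \<sigma> T}"
  have "\<exists>M\<in>?A. \<forall>X\<in>?A. M \<subseteq> X \<longrightarrow> X = M"
  proof (rule subset_Zorn_nonempty)
    show "?A \<noteq> {}" using assms by auto
    fix C assume C: "C \<noteq> {}" "subset.chain ?A C"
    then have CA: "C \<subseteq> ?A" by (simp add: subset.chain_def)
    have "Bot \<notin> der \<sigma> (\<Union>C)"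
    proof
      assume "Bot \<in> der \<sigma> (\<Union>C)"
      from der_finite[OF this] obtain F
        where F: "finite F" "F \<subseteq> \<Union>C" "Bot \<in> der \<sigma> F" by blast
      obtain T where "T \<in> C" "F \<subseteq> T"
        using finite_subset_Union_chain[OF F(1,2) C] by blast
      then show False using CA der_mono[OF F(3)] by auto
    qed
    then show "\<Union>C \<in> ?A" using C(1) CA by blast
  qed
  then obtain T where T: "S \<subseteq> T" "T \<subseteq> Sent \<sigma>" "Bot \<notin> der \<sigma> T"
    and max: "\<And>X. X \<subseteq> Sent \<sigma> \<Longrightarrow> Bot \<notin> der \<sigma> X \<Longrightarrow> T \<subseteq> X \<Longrightarrow> X = T"
    by (auto intro: order_trans)
  have "\<Phi> \<in> T \<or> Neg \<Phi> \<in> T" if \<Phi>: "\<Phi> \<in> Sent \<sigma>" for \<Phi>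
  proof (rule ccontr)
    assume "\<not> (\<Phi> \<in> T \<or> Neg \<Phi> \<in> T)"
    then have ne: "insert \<Phi> T \<noteq> T" "insert (Neg \<Phi>) T \<noteq> T" by auto
    have wf: "wf_fm \<sigma> \<Phi>" using \<Phi> by (simp add: Sent_iff)
    have Bot: "Bot \<in> der \<sigma> (insert \<Phi> T)" "Bot \<in> der \<sigma> (insert (Neg \<Phi>) T)"
      using max[of "insert \<Phi> T"] max[of "insert (Neg \<Phi>) T"] ne \<Phi> T(2) by (auto simp: Sent_iff)
    show False
      using der.mp[OF der_ccontr[OF Bot(2) wf] der_deduct[OF Bot(1) wf]] Sent_Form[OF T(2)] T(3)
      by blast
  qed
  then show ?thesis using that[of T] T by (auto simp: mcs_def)
qed

section \<open>Behaviour of the connectives in a maximal consistent set\<close>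

context
  fixes \<sigma> :: "('p, 'c) signature" and T
  assumes mcs: "mcs \<sigma> T"
begin

lemma mcs_Sent: "T \<subseteq> Sent \<sigma>" and mcs_Form: "T \<subseteq> Form \<sigma>"
  using mcs by (auto simp: mcs_def Sent_def)

lemma mcs_der:
  assumes "\<Phi> \<in> der \<sigma> T" "\<Phi> \<in> Sent \<sigma>"
  shows "\<Phi> \<in> T"
proof (rule ccontr)
  assume "\<Phi> \<notin> T"
  then have "Neg \<Phi> \<in> T" using mcs assms(2) by (auto simp: mcs_def)
  then have "Bot \<in> der \<sigma> T" using assms(1) by (blast intro: der.intros)
  then show False using mcs by (simp add: mcs_def)
qed

lemma mcs_mp: "\<Phi> \<in> T \<Longrightarrow> Imp \<Phi> \<Psi> \<in> der \<sigma> T \<Longrightarrow> \<Psi> \<in> Sent \<sigma> \<Longrightarrow> \<Psi> \<in> T"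
  by (rule mcs_der) (blast intro: der.intros)+

lemma mcs_Bot: "Bot \<notin> T"
  using mcs by (auto simp: mcs_def intro: der.hyp)

lemma mcs_Neg: "\<Phi> \<in> Sent \<sigma> \<Longrightarrow> Neg \<Phi> \<in> T \<longleftrightarrow> \<Phi> \<notin> T"
  using mcs mcs_mp[of \<Phi> Bot] mcs_Bot by (auto simp: mcs_def Sent_iff intro: der.hyp)

lemma mcs_Imp:
  assumes "\<Phi> \<in> Sent \<sigma>" "\<Psi> \<in> Sent \<sigma>"
  shows "Imp \<Phi> \<Psi> \<in> T \<longleftrightarrow> (\<Phi> \<in> T \<longrightarrow> \<Psi> \<in> T)"
proof -
  have wf: "wf_fm \<sigma> \<Phi>" "wf_fm \<sigma> \<Psi>" "Imp \<Phi> \<Psi> \<in> Sent \<sigma>" using assms by (auto simp: Sent_iff)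
  have "Imp \<Phi> \<Psi> \<in> der \<sigma> T" if "\<Psi> \<in> T" using that wf by (intro der_K der.hyp)
  moreover have "Imp \<Phi> \<Psi> \<in> der \<sigma> T" if "Neg \<Phi> \<in> T"
  proof -
    have "Bot \<in> der \<sigma> (insert \<Phi> T)" by (rule der.mp[of \<Phi>]) (use that in \<open>auto intro: der.hyp\<close>)
    then show ?thesis using wf mcs_Form by (intro der_deduct[OF der_efq])
  qed
  ultimately show ?thesis
    using mcs_der[OF _ wf(3)] mcs_mp[of \<Phi> \<Psi>] mcs_Neg[of \<Phi>] assms by (auto intro: der.hyp)
qed

lemma mcs_And:
  assumes "\<Phi> \<in> Sent \<sigma>" "\<Psi> \<in> Sent \<sigma>"
  shows "And \<Phi> \<Psi> \<in> T \<longleftrightarrow> \<Phi> \<in> T \<and> \<Psi> \<in> T"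
proof -
  have wf: "wf_fm \<sigma> \<Phi>" "wf_fm \<sigma> \<Psi>" "And \<Phi> \<Psi> \<in> Sent \<sigma>" using assms by (auto simp: Sent_iff)
  have "\<Phi> \<in> T \<and> \<Psi> \<in> T" if "And \<Phi> \<Psi> \<in> T"
    using der_conjE[OF der.hyp[OF that] wf(1,2)] mcs_der assms by blast
  moreover have "And \<Phi> \<Psi> \<in> T" if "\<Phi> \<in> T" "\<Psi> \<in> T"
    using der_conjI[OF der.hyp der.hyp wf(1,2)] that mcs_der wf by blast
  ultimately show ?thesis by blast
qed

lemma mcs_Or:
  assumes "\<Phi> \<in> Sent \<sigma>" "\<Psi> \<in> Sent \<sigma>"
  shows "Or \<Phi> \<Psi> \<in> T \<longleftrightarrow> \<Phi> \<in> T \<or> \<Psi> \<in> T"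
proof -
  have wf: "wf_fm \<sigma> \<Phi>" "wf_fm \<sigma> \<Psi>" "Or \<Phi> \<Psi> \<in> Sent \<sigma>" using assms by (auto simp: Sent_iff)
  have "\<Phi> \<in> T \<or> \<Psi> \<in> T" if "Or \<Phi> \<Psi> \<in> T"
  proof (rule ccontr)
    assume "\<not> (\<Phi> \<in> T \<or> \<Psi> \<in> T)"
    then have "Neg \<Phi> \<in> der \<sigma> T" "Neg \<Psi> \<in> der \<sigma> T" using mcs_Neg assms by (auto intro: der.hyp)
    then have "Bot \<in> der \<sigma> T" using der_disjE[OF der.hyp[OF that]] wf by simp
    then show False using mcs by (simp add: mcs_def)
  qed
  moreover have "Or \<Phi> \<Psi> \<in> T" if "\<Phi> \<in> T \<or> \<Psi> \<in> T"
    using der_disjI[of \<Phi> \<sigma> T \<Psi>] that mcs_der wf by (blast intro: der.hyp)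
  ultimately show ?thesis by blast
qed

lemma mcs_Iff:
  assumes "Iff \<Phi> \<Psi> \<in> der \<sigma> T" "\<Phi> \<in> Sent \<sigma>" "\<Psi> \<in> Sent \<sigma>"
  shows "\<Phi> \<in> T \<longleftrightarrow> \<Psi> \<in> T"
  using der_conjE[OF assms(1)] assms(2,3) mcs_mp by (auto simp: Sent_iff)

lemma mcs_Iff_ax:
  assumes "Iff \<Phi> \<Psi> \<in> QB3K_axioms" "\<Phi> \<in> Sent \<sigma>" "\<Psi> \<in> Sent \<sigma>"
  shows "\<Phi> \<in> T \<longleftrightarrow> \<Psi> \<in> T"
  by (rule mcs_Iff[OF der_ax]) (use assms in \<open>auto simp: Sent_iff\<close>)

lemma mcs_SNeg_SNeg: "\<Phi> \<in> Sent \<sigma> \<Longrightarrow> SNeg (SNeg \<Phi>) \<in> T \<longleftrightarrow> \<Phi> \<in> T"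
  by (rule mcs_Iff_ax) (auto intro!: QB3K_axioms.intros simp: Sent_iff)

lemma mcs_SNeg_Imp:
  assumes "\<Phi> \<in> Sent \<sigma>" "\<Psi> \<in> Sent \<sigma>"
  shows "SNeg (Imp \<Phi> \<Psi>) \<in> T \<longleftrightarrow> \<Phi> \<in> T \<and> SNeg \<Psi> \<in> T"
proof -
  have "SNeg (Imp \<Phi> \<Psi>) \<in> T \<longleftrightarrow> And \<Phi> (SNeg \<Psi>) \<in> T"
    using assms by (intro mcs_Iff_ax QB3K_axioms.intros) (auto simp: Sent_iff)
  then show ?thesis using assms mcs_And[of \<Phi> "SNeg \<Psi>"] by (auto simp: Sent_iff)
qed

lemma mcs_SNeg_And:
  assumes "\<Phi> \<in> Sent \<sigma>" "\<Psi> \<in> Sent \<sigma>"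
  shows "SNeg (And \<Phi> \<Psi>) \<in> T \<longleftrightarrow> SNeg \<Phi> \<in> T \<or> SNeg \<Psi> \<in> T"
proof -
  have "SNeg (And \<Phi> \<Psi>) \<in> T \<longleftrightarrow> Or (SNeg \<Phi>) (SNeg \<Psi>) \<in> T"
    using assms by (intro mcs_Iff_ax QB3K_axioms.intros) (auto simp: Sent_iff)
  then show ?thesis using assms mcs_Or[of "SNeg \<Phi>" "SNeg \<Psi>"] by (auto simp: Sent_iff)
qed

lemma mcs_SNeg_Or:
  assumes "\<Phi> \<in> Sent \<sigma>" "\<Psi> \<in> Sent \<sigma>"
  shows "SNeg (Or \<Phi> \<Psi>) \<in> T \<longleftrightarrow> SNeg \<Phi> \<in> T \<and> SNeg \<Psi> \<in> T"
proof -
  have "SNeg (Or \<Phi> \<Psi>) \<in> T \<longleftrightarrow> And (SNeg \<Phi>) (SNeg \<Psi>) \<in> T"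
    using assms by (intro mcs_Iff_ax QB3K_axioms.intros) (auto simp: Sent_iff)
  then show ?thesis using assms mcs_And[of "SNeg \<Phi>" "SNeg \<Psi>"] by (auto simp: Sent_iff)
qed

lemma mcs_SNeg_Bot: "SNeg Bot \<in> T"
  by (rule mcs_der[OF der_ax[OF QB3K_axioms.intros(15)]]) (auto simp: Sent_iff)

text \<open>An instance of \<open>\<sim>\<Phi> \<rightarrow> (\<Phi> \<rightarrow> \<Psi>)\<close>
  with \<open>\<Psi>\<close> taken as \<open>Bot\<close>. It is what keeps the positive and negative
  structures of the canonical model disjoint.\<close>

lemma mcs_not_SNeg: "\<Phi> \<in> T \<Longrightarrow> SNeg \<Phi> \<notin> T"
proof
  assume *: "\<Phi> \<in> T" "SNeg \<Phi> \<in> T"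
  have "wf_fm \<sigma> \<Phi>" using * mcs_Sent by (auto simp: Sent_iff)
  then have "Imp (SNeg \<Phi>) (Neg \<Phi>) \<in> der \<sigma> T" by (intro der_ax QB3K_axioms.intros) auto
  then have "Bot \<in> der \<sigma> T" using * by (blast intro: der.intros)
  then show False using mcs by (simp add: mcs_def)
qed

lemma mcs_Neg_Box: "\<Phi> \<in> Sent \<sigma> \<Longrightarrow> Neg (Box \<Phi>) \<in> T \<longleftrightarrow> Dia (Neg \<Phi>) \<in> T"
  by (intro mcs_Iff_ax QB3K_axioms.intros) (auto simp: Sent_iff)

lemma mcs_Neg_Dia: "\<Phi> \<in> Sent \<sigma> \<Longrightarrow> Neg (Dia \<Phi>) \<in> T \<longleftrightarrow> Box (Neg \<Phi>) \<in> T"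
  by (intro mcs_Iff_ax QB3K_axioms.intros) (auto simp: Sent_iff)

text \<open>Uses the half of \<open>SIff\<close> about strong negations. The other half would not
  do, since \<open>Iff\<close> does not license replacement under \<open>SNeg\<close>:
  \<open>And p (SNeg p)\<close> and \<open>Bot\<close> are equivalent, but only the second has a
  provable strong negation.\<close>

lemma mcs_SNeg_Box:
  assumes "\<Phi> \<in> Sent \<sigma>"
  shows "SNeg (Box \<Phi>) \<in> T \<longleftrightarrow> Dia (SNeg \<Phi>) \<in> T"
proof -
  have "SIff (Box \<Phi>) (SNeg (Dia (SNeg \<Phi>))) \<in> der \<sigma> T"
    using assms by (intro der_ax QB3K_axioms.intros) (auto simp: Sent_iff)
  then have "Iff (SNeg (Box \<Phi>)) (SNeg (SNeg (Dia (SNeg \<Phi>)))) \<in> der \<sigma> T"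
    by (rule der_conjE) (use assms in \<open>auto simp: Sent_iff\<close>)
  then have "SNeg (Box \<Phi>) \<in> T \<longleftrightarrow> SNeg (SNeg (Dia (SNeg \<Phi>))) \<in> T"
    by (rule mcs_Iff) (use assms in \<open>auto simp: Sent_iff\<close>)
  then show ?thesis using mcs_SNeg_SNeg assms by (auto simp: Sent_iff)
qed

lemma mcs_SNeg_Dia:
  assumes "\<Phi> \<in> Sent \<sigma>"
  shows "SNeg (Dia \<Phi>) \<in> T \<longleftrightarrow> Box (SNeg \<Phi>) \<in> T"
proof -
  have "SIff (Dia \<Phi>) (SNeg (Box (SNeg \<Phi>))) \<in> der \<sigma> T"
    using assms by (intro der_ax QB3K_axioms.intros) (auto simp: Sent_iff)
  then have "Iff (SNeg (Dia \<Phi>)) (SNeg (SNeg (Box (SNeg \<Phi>)))) \<in> der \<sigma> T"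
    by (rule der_conjE) (use assms in \<open>auto simp: Sent_iff\<close>)
  then have "SNeg (Dia \<Phi>) \<in> T \<longleftrightarrow> SNeg (SNeg (Box (SNeg \<Phi>))) \<in> T"
    by (rule mcs_Iff) (use assms in \<open>auto simp: Sent_iff\<close>)
  then show ?thesis using mcs_SNeg_SNeg assms by (auto simp: Sent_iff)
qed

lemma mcs_SNeg_All: "All x \<Phi> \<in> Sent \<sigma> \<Longrightarrow> SNeg (All x \<Phi>) \<in> T \<longleftrightarrow> Ex x (SNeg \<Phi>) \<in> T"
  by (intro mcs_Iff_ax QB3K_axioms.intros) (auto simp: Sent_iff)

lemma mcs_SNeg_Ex: "Ex x \<Phi> \<in> Sent \<sigma> \<Longrightarrow> SNeg (Ex x \<Phi>) \<in> T \<longleftrightarrow> All x (SNeg \<Phi>) \<in> T"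
  by (intro mcs_Iff_ax QB3K_axioms.intros) (auto simp: Sent_iff)

text \<open>Otherwise the formulas boxed in \<open>T\<close> would derive \<open>Neg \<Phi>\<close>;
  boxing this derivation puts \<open>Box (Neg \<Phi>)\<close> into \<open>T\<close>, which is
  equivalent to \<open>Neg (Dia \<Phi>)\<close>.\<close>

lemma mcs_Dia_consistent:
  assumes "Dia \<Phi> \<in> T"
  shows "Bot \<notin> der \<sigma> (insert \<Phi> {\<Psi>. Box \<Psi> \<in> T})"
proof
  let ?X = "{\<Psi>. Box \<Psi> \<in> T}"
  have X: "?X \<subseteq> Form \<sigma>" and \<Phi>: "\<Phi> \<in> Sent \<sigma>"
    using mcs_Sent assms by (auto simp: Sent_iff Form_def)
  assume "Bot \<in> der \<sigma> (insert \<Phi> ?X)"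
  then have "Neg \<Phi> \<in> der \<sigma> ?X" using X \<Phi> by (intro der_deduct) (auto simp: Sent_iff)
  then have "Box (Neg \<Phi>) \<in> der \<sigma> (Box ` ?X)" using X by (rule der_Box)
  then have "Box (Neg \<Phi>) \<in> der \<sigma> T" by (rule der_mono) auto
  then have "Box (Neg \<Phi>) \<in> T" by (rule mcs_der) (use \<Phi> in \<open>auto simp: Sent_iff\<close>)
  then have "Neg (Dia \<Phi>) \<in> T" using mcs_Neg_Dia \<Phi> by simp
  then show False using mcs_Neg[of "Dia \<Phi>"] assms \<Phi> by (auto simp: Sent_iff)
qed

end

section \<open>Witnessed theories and quantifiers\<close>

definition henkin :: "('p, 'c) signature \<Rightarrow> ('p, 'c) fm set \<Rightarrow> bool" where
  "henkin \<sigma> T \<longleftrightarrow> (\<forall>x \<Phi>. Ex x \<Phi> \<in> T \<longrightarrow> (\<exists>e\<in>csyms \<sigma>. subst1 x (Cst e) \<Phi> \<in> T))"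

lemma free_for_Cst [simp]: "free_for (Cst c) x \<Phi>"
  by (induction \<Phi>) auto

lemma subst1_Cst_Sent:
  assumes "wf_fm \<sigma> \<Phi>" "fv \<Phi> \<subseteq> {x}" "e \<in> csyms \<sigma>"
  shows "subst1 x (Cst e) \<Phi> \<in> Sent \<sigma>"
proof -
  have "fv (subst1 x (Cst e) \<Phi>) = {}"
    unfolding subst1_def using fv_subst[of "Var(x := Cst e)" \<Phi>] assms(2)
    by (fastforce split: if_splits)
  then show ?thesis using assms wf_subst1[of \<sigma> \<Phi> "Cst e" x] by (auto simp: Sent_iff)
qed

lemma mcs_Ex:
  assumes "mcs \<sigma> T" "henkin \<sigma> T" "Ex x \<Phi> \<in> Sent \<sigma>"
  shows "Ex x \<Phi> \<in> T \<longleftrightarrow> (\<exists>e\<in>csyms \<sigma>. subst1 x (Cst e) \<Phi> \<in> T)"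
proof -
  have "Ex x \<Phi> \<in> T" if "e \<in> csyms \<sigma>" "subst1 x (Cst e) \<Phi> \<in> T" for e
  proof -
    have "Imp (subst1 x (Cst e) \<Phi>) (Ex x \<Phi>) \<in> der \<sigma> T"
      by (intro der_ax QB3K_axioms.intros(23)) (use assms(3) that in \<open>auto simp: Sent_iff wf_subst1\<close>)
    then show ?thesis using mcs_mp[OF assms(1) that(2)] assms(3) by blast
  qed
  then show ?thesis using assms(2) by (auto simp: henkin_def)
qed

lemma mcs_All:
  assumes "mcs \<sigma> T" "henkin \<sigma> T" "All x \<Phi> \<in> Sent \<sigma>"
  shows "All x \<Phi> \<in> T \<longleftrightarrow> (\<forall>e\<in>csyms \<sigma>. subst1 x (Cst e) \<Phi> \<in> T)"
proof -
  have wf: "wf_fm \<sigma> \<Phi>" "fv \<Phi> \<subseteq> {x}" using assms(3) by (auto simp: Sent_iff)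
  have inst: "subst1 x (Cst e) \<Phi> \<in> Sent \<sigma>" if "e \<in> csyms \<sigma>" for e
    using wf that by (rule subst1_Cst_Sent)
  have "subst1 x (Cst e) \<Phi> \<in> T" if "e \<in> csyms \<sigma>" "All x \<Phi> \<in> T" for e
  proof -
    have "Imp (All x \<Phi>) (subst1 x (Cst e) \<Phi>) \<in> der \<sigma> T"
      by (intro der_ax QB3K_axioms.intros(22)) (use wf that in \<open>auto simp: wf_subst1\<close>)
    then show ?thesis using mcs_mp[OF assms(1) that(2)] inst[OF that(1)] by blast
  qed
  moreover have "\<exists>e\<in>csyms \<sigma>. subst1 x (Cst e) \<Phi> \<notin> T" if "All x \<Phi> \<notin> T"
  proof -
    have "Neg (All x \<Phi>) \<in> T" using that mcs_Neg[OF assms(1,3)] by simp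
    moreover have "Imp (Neg (All x \<Phi>)) (Ex x (Neg \<Phi>)) \<in> der \<sigma> T"
      by (rule der_mono[OF der_not_All_imp_Ex_not[OF wf(1)]]) simp
    ultimately have "Ex x (Neg \<Phi>) \<in> T"
      by (rule mcs_mp[OF assms(1)]) (use wf in \<open>auto simp: Sent_iff\<close>)
    then obtain e where "e \<in> csyms \<sigma>" "subst1 x (Cst e) (Neg \<Phi>) \<in> T"
      using assms(2) by (auto simp: henkin_def)
    then show ?thesis using mcs_Neg[OF assms(1) inst] by (auto simp: subst1_def)
  qed
  ultimately show ?thesis by blast
qed

section \<open>Henkin witnesses\<close>

text \<open>Individuals name themselves: the same set is the domain of a world and the set of
  constants of its language.\<close>

definition lang :: "('p, 'c) signature \<Rightarrow> 'e set \<Rightarrow> ('p, 'e) signature" where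
  "lang \<sigma> D = \<lparr>psyms = psyms \<sigma>, arity = arity \<sigma>, csyms = D\<rparr>"

text \<open>Parameters lie in every layer, which also keeps the domain non-empty for a signature
  without constants. Level \<open>n\<close> witnesses first appear in layer \<open>Suc n\<close>,
  hence they are fresh for layer \<open>n\<close>.\<close>

definition layer :: "('p, 'c) signature \<Rightarrow> nat \<Rightarrow> ('p, 'c) elem set" where
  "layer \<sigma> n = Con ` csyms \<sigma> \<union> range Par \<union> {Wit k \<Phi> |k \<Phi>. k < n}"

lemma lang_simps [simp]:
  "psyms (lang \<sigma> D) = psyms \<sigma>" "arity (lang \<sigma> D) = arity \<sigma>" "csyms (lang \<sigma> D) = D"
  by (auto simp: lang_def)

lemma wf_trm_lang_mono: "wf_trm (lang \<sigma> D) t \<Longrightarrow> D \<subseteq> D' \<Longrightarrow> wf_trm (lang \<sigma> D') t"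
  by (cases t) auto

lemma wf_lang_mono: "wf_fm (lang \<sigma> D) \<Phi> \<Longrightarrow> D \<subseteq> D' \<Longrightarrow> wf_fm (lang \<sigma> D') \<Phi>"
  by (induction \<Phi>) (auto intro: wf_trm_lang_mono)

lemma Sent_lang_mono: "\<Phi> \<in> Sent (lang \<sigma> D) \<Longrightarrow> D \<subseteq> D' \<Longrightarrow> \<Phi> \<in> Sent (lang \<sigma> D')"
  by (auto simp: Sent_iff intro: wf_lang_mono)

lemma layer_mono: "layer \<sigma> n \<subseteq> layer \<sigma> (Suc n)"
  by (auto simp: layer_def)

lemma set2_fm_subst: "set2_fm (subst s \<Phi>) \<subseteq> set2_fm \<Phi> \<union> (\<Union>x. set_trm (s x))"
proof (induction \<Phi> arbitrary: s)
  case (Atom p ts)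
  have "set_trm (subst_trm s t) \<subseteq> set_trm t \<union> (\<Union>x. set_trm (s x))" for t by (cases t) auto
  then show ?case by fastforce
next
  case (All y \<Phi>)
  have "set2_fm (subst (s(y := Var y)) \<Phi>) \<subseteq> set2_fm \<Phi> \<union> (\<Union>x. set_trm ((s(y := Var y)) x))"
    by (rule All.IH)
  then show ?case by (fastforce split: if_splits)
next
  case (Ex y \<Phi>)
  have "set2_fm (subst (s(y := Var y)) \<Phi>) \<subseteq> set2_fm \<Phi> \<union> (\<Union>x. set_trm ((s(y := Var y)) x))"
    by (rule Ex.IH)
  then show ?case by (fastforce split: if_splits)
next
  case (Imp \<Phi> \<Psi>)
  show ?case using Imp.IH(1)[of s] Imp.IH(2)[of s] by auto
next
  case (And \<Phi> \<Psi>)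
  show ?case using And.IH(1)[of s] And.IH(2)[of s] by auto
next
  case (Or \<Phi> \<Psi>)
  show ?case using Or.IH(1)[of s] Or.IH(2)[of s] by auto
qed simp_all

text \<open>Constants of the formula are subterms of the nested datatype value
  \<open>Wit n \<Phi>\<close>. The strict decrease rules out a witness inside its own formula and
  cycles among witnesses.\<close>

lemma size_less_Wit:
  assumes "e \<in> set2_fm \<Phi>"
  shows "size e < size (Wit n \<Phi>)"
proof -
  have trm: "size e \<le> size_trm size t" if "e \<in> set_trm t" for t using that by (cases t) auto
  have "size e \<le> size_fm (\<lambda>_. 0) size \<Phi>"
    using assms
  proof (induction \<Phi>)
    case (Atom p ts)
    then obtain t where "t \<in> set ts" "e \<in> set_trm t" by auto
    then have "size e \<le> size_list (size_trm size) ts"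
      using trm by (meson order_trans size_list_estimation')
    then show ?case by simp
  qed auto
  then show ?thesis by simp
qed

text \<open>The filler \<open>Imp Bot Bot\<close> is a sentence without constants, so the facts on
  constants and on membership in \<open>Sent\<close> hold uniformly for all formulas.\<close>

fun henkin_ax :: "nat \<Rightarrow> ('p, ('p, 'c) elem) fm \<Rightarrow> ('p, ('p, 'c) elem) fm" where
  "henkin_ax n (Ex x \<Phi>) = Imp (Ex x \<Phi>) (subst1 x (Cst (Wit n (Ex x \<Phi>))) \<Phi>)"
| "henkin_ax n _ = Imp Bot Bot"

lemma set2_henkin_ax: "set2_fm (henkin_ax n \<Phi>) \<subseteq> insert (Wit n \<Phi>) (set2_fm \<Phi>)"
proof (cases \<Phi>)
  case (Ex x \<Psi>)
  have "set2_fm (subst1 x (Cst (Wit n \<Phi>)) \<Psi>) \<subseteq> insert (Wit n \<Phi>) (set2_fm \<Psi>)"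
    unfolding subst1_def
    using set2_fm_subst[of "Var(x := Cst (Wit n \<Phi>))" \<Psi>] by (fastforce split: if_splits)
  then show ?thesis using Ex by auto
qed auto

lemma henkin_ax_Sent:
  assumes "\<Phi> \<in> Sent (lang \<sigma> (layer \<sigma> (Suc n)))"
  shows "henkin_ax n \<Phi> \<in> Sent (lang \<sigma> (layer \<sigma> (Suc n)))"
proof (cases \<Phi>)
  case (Ex x \<Psi>)
  have "subst1 x (Cst (Wit n (Ex x \<Psi>))) \<Psi> \<in> Sent (lang \<sigma> (layer \<sigma> (Suc n)))"
    by (rule subst1_Cst_Sent) (use assms Ex in \<open>auto simp: Sent_iff layer_def\<close>)
  then show ?thesis using Ex assms by (auto simp: Sent_iff)
qed (auto simp: Sent_iff)

lemma Wit_notin_layer: "\<Phi> \<in> Sent (lang \<sigma> (layer \<sigma> n)) \<Longrightarrow> Wit n \<Psi> \<notin> set2_fm \<Phi>"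
  using wf_set2_fm[of "lang \<sigma> (layer \<sigma> n)" \<Phi>] by (auto simp: Sent_iff layer_def)

text \<open>Adding constants is conservative. All new ones may be sent to a single variable, because
  they occur neither in \<open>S\<close> nor in the conclusion \<open>Bot\<close>.\<close>

lemma der_next_layer:
  assumes "S \<subseteq> Sent (lang \<sigma> (layer \<sigma> n))" "Bot \<in> der (lang \<sigma> (layer \<sigma> (Suc n))) S"
  shows "Bot \<in> der (lang \<sigma> (layer \<sigma> n)) S"
proof -
  let ?\<tau> = "lang \<sigma> (layer \<sigma> n)"
  obtain V where V: "finite V"
    "\<And>r. (\<And>c. fv_trm (r c) \<inter> V = {}) \<Longrightarrow>
      (\<And>c. c \<in> csyms (lang \<sigma> (layer \<sigma> (Suc n))) \<Longrightarrow> wf_trm ?\<tau> (r c)) \<Longrightarrow>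
      repl r Bot \<in> der ?\<tau> (repl r ` S)"
    by (rule der_repl[OF _ _ assms(2), of ?\<tau>]) (simp, simp, iprover)
  obtain y where y: "y \<notin> V" using ex_new_if_finite[OF infinite_UNIV_nat V(1)] by metis
  let ?r = "\<lambda>e. if e \<in> layer \<sigma> n then Cst e else Var y"
  have "repl ?r Bot \<in> der ?\<tau> (repl ?r ` S)"
    by (rule V(2)) (use y in auto)
  moreover have "repl ?r \<Phi> = \<Phi>" if "\<Phi> \<in> S" for \<Phi>
  proof -
    have "set2_fm \<Phi> \<subseteq> layer \<sigma> n"
      using that assms(1) wf_set2_fm[of ?\<tau> \<Phi>] Sent_iff[of \<Phi> ?\<tau>] by auto
    then show ?thesis by (intro repl_id) auto
  qed
  then have "repl ?r ` S = S" by force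
  ultimately show ?thesis by simp
qed

text \<open>A finite set of Henkin axioms is removed one by one, largest witness first: a witness
  properly contains its formula, so the largest one occurs in no other axiom.\<close>

lemma henkin_ax_consistent:
  assumes S: "S \<subseteq> Sent (lang \<sigma> (layer \<sigma> n))" "Bot \<notin> der (lang \<sigma> (layer \<sigma> n)) S"
    and "finite E" "E \<subseteq> Sent (lang \<sigma> (layer \<sigma> (Suc n)))" "\<And>\<Phi>. \<Phi> \<in> E \<Longrightarrow> \<exists>x \<Psi>. \<Phi> = Ex x \<Psi>"
  shows "Bot \<notin> der (lang \<sigma> (layer \<sigma> (Suc n))) (S \<union> henkin_ax n ` E)"
  using assms(3-)
proof (induction E rule: finite_psubset_induct)
  case (psubset E)
  let ?\<tau> = "lang \<sigma> (layer \<sigma> (Suc n))"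
  show ?case
  proof (cases "E = {}")
    case True
    then show ?thesis using S der_next_layer by auto
  next
    case False
    define f where "f \<Phi> = size (Wit n \<Phi> :: ('a, 'b) elem)" for \<Phi>
    obtain \<chi> where \<chi>: "\<chi> \<in> E" "f \<chi> = Max (f ` E)"
      using psubset.hyps False by (metis (mono_tags) Max_in finite_imageI image_iff image_is_empty)
    then have max: "f \<Phi> \<le> f \<chi>" if "\<Phi> \<in> E" for \<Phi> using that psubset.hyps by simp
    obtain x \<Psi> where \<Psi>: "\<chi> = Ex x \<Psi>" using psubset.prems(2) \<chi>(1) by blast
    let ?T = "S \<union> henkin_ax n ` (E - {\<chi>})"
    have IH: "Bot \<notin> der ?\<tau> ?T"
      by (rule psubset.IH) (use \<chi>(1) psubset.prems in auto)
    show ?thesis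
    proof
      assume "Bot \<in> der ?\<tau> (S \<union> henkin_ax n ` E)"
      moreover have "S \<union> henkin_ax n ` E = insert (henkin_ax n \<chi>) ?T" using \<chi>(1) by auto
      ultimately have "Bot \<in> der ?\<tau> (insert (Imp (Ex x \<Psi>) (subst1 x (Cst (Wit n \<chi>)) \<Psi>)) ?T)"
        using \<Psi> by simp
      then have "Bot \<in> der ?\<tau> ?T"
      proof (rule der_Henkin_axiom)
        have "\<Phi> \<in> Sent ?\<tau>" if "\<Phi> \<in> S" for \<Phi>
          using that S(1) by (intro Sent_lang_mono[OF _ layer_mono]) auto
        then show "?T \<subseteq> Sent ?\<tau>" using psubset.prems(1) by (auto intro: henkin_ax_Sent)
        show "Ex x \<Psi> \<in> Sent ?\<tau>" using \<Psi> \<chi>(1) psubset.prems(1) by auto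
        show "Wit n \<chi> \<in> csyms ?\<tau>" by (auto simp: layer_def)
        show "Wit n \<chi> \<notin> set2_fm \<Psi>" using size_less_Wit[of "Wit n \<chi>" \<chi> n] \<Psi> by auto
        fix \<Phi> assume "\<Phi> \<in> ?T"
        then show "Wit n \<chi> \<notin> set2_fm \<Phi>"
        proof
          assume "\<Phi> \<in> S"
          then show ?thesis using S(1) Wit_notin_layer by blast
        next
          assume "\<Phi> \<in> henkin_ax n ` (E - {\<chi>})"
          then obtain \<Phi>' where \<Phi>': "\<Phi> = henkin_ax n \<Phi>'" "\<Phi>' \<in> E" "\<Phi>' \<noteq> \<chi>" by auto
          \<comment> \<open>Several witnesses may share the maximal size. This does no harm:
            containment makes the size strictly smaller, and distinct formulas have distinct
            witnesses.\<close>
          have "Wit n \<chi> \<notin> set2_fm \<Phi>'"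
            using size_less_Wit[of "Wit n \<chi>" \<Phi>' n] max[OF \<Phi>'(2)] by (auto simp: f_def)
          then show ?thesis using set2_henkin_ax[of n \<Phi>'] \<Phi>' by auto
        qed
      qed
      then show False using IH by simp
    qed
  qed
qed

text \<open>A single new layer suffices, without a limit construction: the formula indexing a
  witness of level \<open>n\<close> may itself contain witnesses of level \<open>n\<close>, so
  existential sentences of the enlarged language already have their witnesses in it.\<close>

lemma henkin_extension:
  assumes S: "S \<subseteq> Sent (lang \<sigma> (layer \<sigma> n))" "Bot \<notin> der (lang \<sigma> (layer \<sigma> n)) S"
  obtains T where "S \<subseteq> T" "mcs (lang \<sigma> (layer \<sigma> (Suc n))) T" "henkin (lang \<sigma> (layer \<sigma> (Suc n))) T"
proof -
  let ?\<tau> = "lang \<sigma> (layer \<sigma> (Suc n))"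
  let ?E = "{\<Phi> \<in> Sent ?\<tau>. \<exists>x \<Psi>. \<Phi> = Ex x \<Psi>}"
  have consistent: "Bot \<notin> der ?\<tau> (S \<union> henkin_ax n ` ?E)"
  proof
    assume "Bot \<in> der ?\<tau> (S \<union> henkin_ax n ` ?E)"
    from der_finite[OF this] obtain F
      where F: "finite F" "F \<subseteq> S \<union> henkin_ax n ` ?E" "Bot \<in> der ?\<tau> F" by blast
    have "finite (F - S)" "F - S \<subseteq> henkin_ax n ` ?E" using F by auto
    then obtain E where E: "E \<subseteq> ?E" "finite E" "F - S = henkin_ax n ` E"
      by (auto dest: finite_subset_image)
    have "Bot \<in> der ?\<tau> (S \<union> henkin_ax n ` E)" by (rule der_mono[OF F(3)]) (use E(3) in auto)
    moreover have "Bot \<notin> der ?\<tau> (S \<union> henkin_ax n ` E)"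
      by (rule henkin_ax_consistent[OF S E(2)]) (use E(1) in auto)
    ultimately show False by simp
  qed
  have "S \<union> henkin_ax n ` ?E \<subseteq> Sent ?\<tau>"
  proof -
    have "\<Phi> \<in> Sent ?\<tau>" if "\<Phi> \<in> S" for \<Phi>
      using that S(1) by (intro Sent_lang_mono[OF _ layer_mono]) auto
    then show ?thesis by (auto intro: henkin_ax_Sent)
  qed
  then obtain T where T: "S \<union> henkin_ax n ` ?E \<subseteq> T" "mcs ?\<tau> T"
    by (rule Lindenbaum[OF _ consistent])
  have "\<exists>e\<in>csyms ?\<tau>. subst1 x (Cst e) \<Phi> \<in> T" if Ex: "Ex x \<Phi> \<in> T" for x \<Phi>
  proof -
    have s: "Ex x \<Phi> \<in> Sent ?\<tau>" using Ex mcs_Sent[OF T(2)] by auto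
    then have "henkin_ax n (Ex x \<Phi>) \<in> T" "henkin_ax n (Ex x \<Phi>) \<in> Sent ?\<tau>"
      using T(1) henkin_ax_Sent by blast+
    then have "subst1 x (Cst (Wit n (Ex x \<Phi>))) \<Phi> \<in> T"
      by (intro mcs_mp[OF T(2) Ex]) (auto simp: Sent_iff intro: der.hyp)
    then show ?thesis by (auto simp: layer_def)
  qed
  then show ?thesis using that[of T] T by (auto simp: henkin_def)
qed

section \<open>The canonical model\<close>

definition canon_worlds :: "('p, 'c) signature \<Rightarrow> ('p, 'c) world set" where
  "canon_worlds \<sigma> =
    {(T, D). (\<exists>n. D = layer \<sigma> n) \<and> mcs (lang \<sigma> D) T \<and> henkin (lang \<sigma> D) T}"

text \<open>Accessibility refers to \<open>Box\<close> alone. The behaviour of \<open>Dia\<close>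
  follows from the axioms for \<open>Neg\<close>, and that of strongly negated modal formulas from
  the two \<open>SIff\<close> axioms.\<close>

definition canon :: "('p, 'c) signature \<Rightarrow> ('p, 'c, ('p, 'c) world, ('p, 'c) elem) model" where
  "canon \<sigma> =
    \<lparr>worlds = canon_worlds \<sigma>,
     acc = {(w, v) \<in> canon_worlds \<sigma> \<times> canon_worlds \<sigma>.
       snd w \<subseteq> snd v \<and> (\<forall>\<Psi>. Box \<Psi> \<in> fst w \<longrightarrow> \<Psi> \<in> fst v)},
     pos = (\<lambda>w. \<lparr>domain = snd w, cint = Con, pint = (\<lambda>p. {es. Atom p (map Cst es) \<in> fst w})\<rparr>),
     neg = (\<lambda>w. \<lparr>domain = snd w, cint = Con, pint = (\<lambda>p. {es. SNeg (Atom p (map Cst es)) \<in> fst w})\<rparr>)\<rparr>"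

lemma canon_simps [simp]:
  "worlds (canon \<sigma>) = canon_worlds \<sigma>"
  "(w, v) \<in> acc (canon \<sigma>) \<longleftrightarrow> w \<in> canon_worlds \<sigma> \<and> v \<in> canon_worlds \<sigma> \<and>
    snd w \<subseteq> snd v \<and> (\<forall>\<Psi>. Box \<Psi> \<in> fst w \<longrightarrow> \<Psi> \<in> fst v)"
  "domain (pos (canon \<sigma>) w) = snd w" "domain (neg (canon \<sigma>) w) = snd w"
  "cint (pos (canon \<sigma>) w) = Con" "cint (neg (canon \<sigma>) w) = Con"
  "pint (pos (canon \<sigma>) w) p = {es. Atom p (map Cst es) \<in> fst w}"
  "pint (neg (canon \<sigma>) w) p = {es. SNeg (Atom p (map Cst es)) \<in> fst w}"
  by (auto simp: canon_def)

lemma canon_worldD: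
  assumes "w \<in> canon_worlds \<sigma>"
  shows "mcs (lang \<sigma> (snd w)) (fst w)" "henkin (lang \<sigma> (snd w)) (fst w)"
    "Con ` csyms \<sigma> \<subseteq> snd w" "range Par \<subseteq> snd w"
  using assms by (auto simp: canon_worlds_def layer_def)

lemma canon_Dia:
  assumes w: "w \<in> canon_worlds \<sigma>" and \<Phi>: "\<Phi> \<in> Sent (lang \<sigma> (snd w))"
  shows "Dia \<Phi> \<in> fst w \<longleftrightarrow> (\<exists>v. (w, v) \<in> acc (canon \<sigma>) \<and> \<Phi> \<in> fst v)"
proof
  assume Dia: "Dia \<Phi> \<in> fst w"
  obtain n where n: "snd w = layer \<sigma> n" using w by (auto simp: canon_worlds_def)
  let ?S = "insert \<Phi> {\<Psi>. Box \<Psi> \<in> fst w}"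
  note mcs = canon_worldD(1)[OF w, unfolded n]
  have "?S \<subseteq> Sent (lang \<sigma> (layer \<sigma> n))"
    using mcs_Sent[OF mcs] \<Phi> n by (auto simp: Sent_iff)
  then obtain T where T: "?S \<subseteq> T" "mcs (lang \<sigma> (layer \<sigma> (Suc n))) T"
    "henkin (lang \<sigma> (layer \<sigma> (Suc n))) T"
    by (rule henkin_extension[OF _ mcs_Dia_consistent[OF mcs Dia]])
  then have "(w, (T, layer \<sigma> (Suc n))) \<in> acc (canon \<sigma>) \<and> \<Phi> \<in> T"
    using w n layer_mono[of \<sigma> n] by (auto simp: canon_worlds_def)
  then show "\<exists>v. (w, v) \<in> acc (canon \<sigma>) \<and> \<Phi> \<in> fst v" by auto
next
  assume "\<exists>v. (w, v) \<in> acc (canon \<sigma>) \<and> \<Phi> \<in> fst v"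
  then obtain v where v: "v \<in> canon_worlds \<sigma>" "snd w \<subseteq> snd v" "\<Phi> \<in> fst v"
    "\<And>\<Psi>. Box \<Psi> \<in> fst w \<Longrightarrow> \<Psi> \<in> fst v" by auto
  note mcs = canon_worldD(1)[OF w]
  have s: "Dia \<Phi> \<in> Sent (lang \<sigma> (snd w))" using \<Phi> by (auto simp: Sent_iff)
  show "Dia \<Phi> \<in> fst w"
  proof (rule ccontr)
    assume "Dia \<Phi> \<notin> fst w"
    then have "Box (Neg \<Phi>) \<in> fst w"
      using mcs_Neg[OF mcs s] mcs_Neg_Dia[OF mcs \<Phi>] by simp
    then have "Neg \<Phi> \<in> fst v" using v(4) by blast
    then show False
      using v(3) mcs_Neg[OF canon_worldD(1)[OF v(1)] Sent_lang_mono[OF \<Phi> v(2)]] by simp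
  qed
qed

text \<open>Classical negation reduces this to \<open>canon_Dia\<close>, so the existence of
  successors is proved only once.\<close>

lemma canon_Box:
  assumes w: "w \<in> canon_worlds \<sigma>" and \<Phi>: "\<Phi> \<in> Sent (lang \<sigma> (snd w))"
  shows "Box \<Phi> \<in> fst w \<longleftrightarrow> (\<forall>v. (w, v) \<in> acc (canon \<sigma>) \<longrightarrow> \<Phi> \<in> fst v)"
proof -
  note mcs = canon_worldD(1)[OF w]
  have s: "Box \<Phi> \<in> Sent (lang \<sigma> (snd w))" "Neg \<Phi> \<in> Sent (lang \<sigma> (snd w))"
    using \<Phi> by (auto simp: Sent_iff)
  have "Box \<Phi> \<notin> fst w \<longleftrightarrow> (\<exists>v. (w, v) \<in> acc (canon \<sigma>) \<and> Neg \<Phi> \<in> fst v)"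
    using mcs_Neg[OF mcs s(1)] mcs_Neg_Box[OF mcs \<Phi>] canon_Dia[OF w s(2)] by simp
  moreover have "Neg \<Phi> \<in> fst v \<longleftrightarrow> \<Phi> \<notin> fst v" if "(w, v) \<in> acc (canon \<sigma>)" for v
    using that by (intro mcs_Neg[OF canon_worldD(1) Sent_lang_mono[OF \<Phi>]]) auto
  ultimately show ?thesis by blast
qed

text \<open>Sentences of the semantics distinguish a constant \<open>c\<close> from the name of the
  individual \<open>Con c\<close>; the language of a canonical world has one constant for
  both.\<close>

definition den :: "'c + ('p, 'c) elem \<Rightarrow> ('p, 'c) elem trm" where
  "den c = (case c of Inl c \<Rightarrow> Cst (Con c) | Inr e \<Rightarrow> Cst e)"

lemma den_simps [simp]: "den (Inl c) = Cst (Con c)" "den (Inr e) = Cst e"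
  by (auto simp: den_def)

lemma fv_den [simp]: "fv_trm (den c) = {}"
  by (cases c) auto

lemma den_Sent:
  assumes "\<Phi> \<in> Sent (expand \<sigma> D)" "Con ` csyms \<sigma> \<subseteq> D"
  shows "repl den \<Phi> \<in> Sent (lang \<sigma> D)"
proof -
  have "wf_fm (lang \<sigma> D) (repl den \<Phi>)"
    by (rule wf_repl[of _ "expand \<sigma> D"]) (use assms in \<open>auto simp: Sent_iff expand_def\<close>)
  then show ?thesis using assms(1) by (simp add: Sent_iff fv_repl_closed)
qed

lemma wf_trm_expand_mono: "wf_trm (expand \<sigma> D) t \<Longrightarrow> D \<subseteq> D' \<Longrightarrow> wf_trm (expand \<sigma> D') t"
  by (cases t) (auto simp: expand_def)

lemma wf_expand_mono: "wf_fm (expand \<sigma> D) \<Phi> \<Longrightarrow> D \<subseteq> D' \<Longrightarrow> wf_fm (expand \<sigma> D') \<Phi>"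
proof (induction \<Phi>)
  case (Atom p ts)
  then show ?case using wf_trm_expand_mono[of \<sigma> D _ D'] by (auto simp: expand_def)
qed auto

lemma Sent_expand_mono: "\<Phi> \<in> Sent (expand \<sigma> D) \<Longrightarrow> D \<subseteq> D' \<Longrightarrow> \<Phi> \<in> Sent (expand \<sigma> D')"
  by (auto simp: Sent_iff intro: wf_expand_mono)

lemma repl_den_closed:
  assumes "fv_trm t = {}" "cint \<AA> = Con"
  shows "repl_trm den t = Cst (tval \<AA> t)"
proof (cases t)
  case (Cst c)
  then show ?thesis using assms(2) by (cases c) auto
qed (use assms in simp)

lemma repl_den_subst1: "repl den (subst1 x (name e) \<Phi>) = subst1 x (Cst e) (repl den \<Phi>)"
  by (subst repl_subst1) auto

text \<open>Induction on depth rather than on structure, because the quantifier clauses pass to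
  instances, which are not subformulas. Verification and falsification go together:
  \<open>SNeg\<close> swaps them, and falsifying an implication involves both.\<close>

lemma truth_lemma:
  assumes "w \<in> canon_worlds \<sigma>" "\<Phi> \<in> Sent (expand \<sigma> (snd w))"
  shows "(verified (canon \<sigma>) w \<Phi> \<longleftrightarrow> repl den \<Phi> \<in> fst w) \<and>
         (falsified (canon \<sigma>) w \<Phi> \<longleftrightarrow> SNeg (repl den \<Phi>) \<in> fst w)"
  using assms
proof (induction "depth \<Phi>" arbitrary: \<Phi> w rule: less_induct)
  case less
  let ?M = "canon \<sigma>"
  note w = less.prems(1)
  note mcs = canon_worldD(1)[OF w] and henkin = canon_worldD(2)[OF w] and Con = canon_worldD(3)[OF w]
  have IH: "verified ?M v \<Psi> \<longleftrightarrow> repl den \<Psi> \<in> fst v" "falsified ?M v \<Psi> \<longleftrightarrow> SNeg (repl den \<Psi>) \<in> fst v"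
    if "depth \<Psi> < depth \<Phi>" "v \<in> canon_worlds \<sigma>" "\<Psi> \<in> Sent (expand \<sigma> (snd v))" for \<Psi> v
    using less.hyps[OF that] by auto
  show ?case
  proof (cases \<Phi>)
    case (Atom p ts)
    have ts: "fv_trm t = {}" if "t \<in> set ts" for t using less.prems(2) Atom that by (auto simp: Sent_iff)
    have "map (repl_trm den) ts = map Cst (map (tval (pos ?M w)) ts)"
      using repl_den_closed[OF ts, of _ "pos ?M w"] by simp
    moreover have "map (repl_trm den) ts = map Cst (map (tval (neg ?M w)) ts)"
      using repl_den_closed[OF ts, of _ "neg ?M w"] by simp
    ultimately show ?thesis using Atom by (simp add: sat_atom_def del: map_map)
  next
    case Bot
    then show ?thesis using mcs_Bot[OF mcs] mcs_SNeg_Bot[OF mcs] by simp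
  next
    case (Imp \<Psi> \<Theta>)
    then have s: "\<Psi> \<in> Sent (expand \<sigma> (snd w))" "\<Theta> \<in> Sent (expand \<sigma> (snd w))"
      using less.prems(2) by (auto simp: Sent_iff)
    show ?thesis
      using IH[OF _ w s(1)] IH[OF _ w s(2)] mcs_Imp[OF mcs den_Sent[OF s(1) Con] den_Sent[OF s(2) Con]]
        mcs_SNeg_Imp[OF mcs den_Sent[OF s(1) Con] den_Sent[OF s(2) Con]] Imp by auto
  next
    case (And \<Psi> \<Theta>)
    then have s: "\<Psi> \<in> Sent (expand \<sigma> (snd w))" "\<Theta> \<in> Sent (expand \<sigma> (snd w))"
      using less.prems(2) by (auto simp: Sent_iff)
    show ?thesis
      using IH[OF _ w s(1)] IH[OF _ w s(2)] mcs_And[OF mcs den_Sent[OF s(1) Con] den_Sent[OF s(2) Con]]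
        mcs_SNeg_And[OF mcs den_Sent[OF s(1) Con] den_Sent[OF s(2) Con]] And by auto
  next
    case (Or \<Psi> \<Theta>)
    then have s: "\<Psi> \<in> Sent (expand \<sigma> (snd w))" "\<Theta> \<in> Sent (expand \<sigma> (snd w))"
      using less.prems(2) by (auto simp: Sent_iff)
    show ?thesis
      using IH[OF _ w s(1)] IH[OF _ w s(2)] mcs_Or[OF mcs den_Sent[OF s(1) Con] den_Sent[OF s(2) Con]]
        mcs_SNeg_Or[OF mcs den_Sent[OF s(1) Con] den_Sent[OF s(2) Con]] Or by auto
  next
    case (SNeg \<Psi>)
    then have s: "\<Psi> \<in> Sent (expand \<sigma> (snd w))" using less.prems(2) by (auto simp: Sent_iff)
    show ?thesis using IH[OF _ w s] mcs_SNeg_SNeg[OF mcs den_Sent[OF s Con]] SNeg by auto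
  next
    case (Box \<Psi>)
    then have s: "\<Psi> \<in> Sent (expand \<sigma> (snd w))" using less.prems(2) by (auto simp: Sent_iff)
    then have s': "repl den \<Psi> \<in> Sent (lang \<sigma> (snd w))" "SNeg (repl den \<Psi>) \<in> Sent (lang \<sigma> (snd w))"
      using den_Sent[OF s Con] by (auto simp: Sent_iff)
    have IH': "(verified ?M v \<Psi> \<longleftrightarrow> repl den \<Psi> \<in> fst v) \<and>
        (falsified ?M v \<Psi> \<longleftrightarrow> SNeg (repl den \<Psi>) \<in> fst v)" if "(w, v) \<in> acc ?M" for v
      using that IH[of \<Psi> v] Sent_expand_mono[OF s, of "snd v"] Box by auto
    show ?thesis
      unfolding Box verified.simps falsified.simps repl.simps
      using canon_Box[OF w s'(1)] canon_Dia[OF w s'(2)] mcs_SNeg_Box[OF mcs s'(1)] IH' by blast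
  next
    case (Dia \<Psi>)
    then have s: "\<Psi> \<in> Sent (expand \<sigma> (snd w))" using less.prems(2) by (auto simp: Sent_iff)
    then have s': "repl den \<Psi> \<in> Sent (lang \<sigma> (snd w))" "SNeg (repl den \<Psi>) \<in> Sent (lang \<sigma> (snd w))"
      using den_Sent[OF s Con] by (auto simp: Sent_iff)
    have IH': "(verified ?M v \<Psi> \<longleftrightarrow> repl den \<Psi> \<in> fst v) \<and>
        (falsified ?M v \<Psi> \<longleftrightarrow> SNeg (repl den \<Psi>) \<in> fst v)" if "(w, v) \<in> acc ?M" for v
      using that IH[of \<Psi> v] Sent_expand_mono[OF s, of "snd v"] Dia by auto
    show ?thesis
      unfolding Dia verified.simps falsified.simps repl.simps
      using canon_Dia[OF w s'(1)] canon_Box[OF w s'(2)] mcs_SNeg_Dia[OF mcs s'(1)] IH' by blast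
  next
    case (All x \<Psi>)
    have wf: "wf_fm (expand \<sigma> (snd w)) \<Psi>" "fv \<Psi> \<subseteq> {x}"
      using less.prems(2) All by (auto simp: Sent_iff)
    have s': "All x (repl den \<Psi>) \<in> Sent (lang \<sigma> (snd w))"
      using den_Sent[OF less.prems(2) Con] All by simp
    have IH': "(verified ?M w (subst1 x (name e) \<Psi>) \<longleftrightarrow> subst1 x (Cst e) (repl den \<Psi>) \<in> fst w) \<and>
        (falsified ?M w (subst1 x (name e) \<Psi>) \<longleftrightarrow> subst1 x (Cst e) (SNeg (repl den \<Psi>)) \<in> fst w)"
      if "e \<in> snd w" for e
    proof -
      have "subst1 x (name e) \<Psi> \<in> Sent (expand \<sigma> (snd w))"
        by (rule subst1_Cst_Sent[OF wf]) (use that in \<open>auto simp: expand_def\<close>)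
      then show ?thesis
        using IH[of "subst1 x (name e) \<Psi>" w] w All by (simp add: repl_den_subst1) (simp add: subst1_def)
    qed
    have "Ex x (SNeg (repl den \<Psi>)) \<in> Sent (lang \<sigma> (snd w))" using s' by (auto simp: Sent_iff)
    from mcs_All[OF mcs henkin s'] mcs_Ex[OF mcs henkin this] mcs_SNeg_All[OF mcs s'] IH' show ?thesis
      unfolding All by auto
  next
    case (Ex x \<Psi>)
    have wf: "wf_fm (expand \<sigma> (snd w)) \<Psi>" "fv \<Psi> \<subseteq> {x}"
      using less.prems(2) Ex by (auto simp: Sent_iff)
    have s': "Ex x (repl den \<Psi>) \<in> Sent (lang \<sigma> (snd w))"
      using den_Sent[OF less.prems(2) Con] Ex by simp
    have IH': "(verified ?M w (subst1 x (name e) \<Psi>) \<longleftrightarrow> subst1 x (Cst e) (repl den \<Psi>) \<in> fst w) \<and>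
        (falsified ?M w (subst1 x (name e) \<Psi>) \<longleftrightarrow> subst1 x (Cst e) (SNeg (repl den \<Psi>)) \<in> fst w)"
      if "e \<in> snd w" for e
    proof -
      have "subst1 x (name e) \<Psi> \<in> Sent (expand \<sigma> (snd w))"
        by (rule subst1_Cst_Sent[OF wf]) (use that in \<open>auto simp: expand_def\<close>)
      then show ?thesis
        using IH[of "subst1 x (name e) \<Psi>" w] w Ex by (simp add: repl_den_subst1) (simp add: subst1_def)
    qed
    have "All x (SNeg (repl den \<Psi>)) \<in> Sent (lang \<sigma> (snd w))" using s' by (auto simp: Sent_iff)
    from mcs_Ex[OF mcs henkin s'] mcs_All[OF mcs henkin this] mcs_SNeg_Ex[OF mcs s'] IH' show ?thesis
      unfolding Ex by auto
  qed
qed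

lemma canon_QB3K_model:
  assumes "canon_worlds \<sigma> \<noteq> {}"
  shows "QB3K_model \<sigma> (canon \<sigma>)"
proof -
  have at: "set es \<subseteq> snd w \<and> length es = arity \<sigma> p"
    if "w \<in> canon_worlds \<sigma>" "Atom p (map Cst es) \<in> fst w \<or> SNeg (Atom p (map Cst es)) \<in> fst w"
    for w p es
    using that mcs_Sent[OF canon_worldD(1)[OF that(1)]] by (auto simp: Sent_iff)
  have "is_struct \<sigma> (pos (canon \<sigma>) w)" "is_struct \<sigma> (neg (canon \<sigma>) w)"
    if "w \<in> canon_worlds \<sigma>" for w
    using canon_worldD(3,4)[OF that] at[OF that] unfolding is_struct_def by (auto, blast+)
  then have "QBK_model \<sigma> (canon \<sigma>)"
    using assms unfolding QBK_model_def by (auto simp del: split_paired_All)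
  \<comment> \<open>For atoms the truth lemma turns a clash of the two structures into a theory that
    contains a sentence together with its strong negation.\<close>
  moreover have False
    if "w \<in> canon_worlds \<sigma>" "Atom p ts \<in> Sent (expand \<sigma> (snd w))"
      "sat_atom (pos (canon \<sigma>) w) p ts" "sat_atom (neg (canon \<sigma>) w) p ts" for w p ts
    using that(3,4) truth_lemma[OF that(1,2)] mcs_not_SNeg[OF canon_worldD(1)[OF that(1)]] by auto
  ultimately show ?thesis by (auto simp: QB3K_model_def)
qed

section \<open>Completeness\<close>

text \<open>The list is processed by excluded middle: the head is either a disjunct that holds, or
  its negation joins \<open>T\<close> for the rest of the list.\<close>

lemma der_disj:
  assumes "Bot \<in> der \<sigma> (T \<union> Neg ` set \<Phi>s)" "T \<subseteq> Form \<sigma>" "set \<Phi>s \<subseteq> Form \<sigma>"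
  shows "disj \<Phi>s \<in> der \<sigma> T"
  using assms
proof (induction \<Phi>s arbitrary: T rule: disj.induct)
  case (3 \<Phi> \<Psi> \<Phi>s)
  let ?D = "disj (\<Psi> # \<Phi>s)"
  have wf: "wf_fm \<sigma> \<Phi>" using 3(4) by (auto simp: Form_def)
  have NT: "insert (Neg \<Phi>) T \<subseteq> Form \<sigma>" using wf 3(3) by (auto simp: Form_def)
  have D: "?D \<in> der \<sigma> (insert (Neg \<Phi>) T)" by (rule 3(1)) (use 3 NT in \<open>auto simp: insert_commute\<close>)
  then have wfD: "wf_fm \<sigma> ?D" using NT by (rule der_wf)
  have "Or \<Phi> ?D \<in> der \<sigma> T"
  proof (rule der_disjE)
    show "Or \<Phi> (Neg \<Phi>) \<in> der \<sigma> T" using wf by (intro der_ax QB3K_axioms.intros) auto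
    show "Imp \<Phi> (Or \<Phi> ?D) \<in> der \<sigma> T" using wf wfD by (intro der_ax QB3K_axioms.intros) auto
    show "Imp (Neg \<Phi>) (Or \<Phi> ?D) \<in> der \<sigma> T"
      by (rule der_deduct[OF der_disjI]) (use D wf wfD 3(3) in auto)
  qed (use wf wfD in auto)
  then show ?case by simp
next
  case (2 \<Phi>)
  have "\<Phi> \<in> der \<sigma> T" by (rule der_ccontr) (use 2 in \<open>auto simp: Form_def\<close>)
  then show ?case by simp
qed simp

lemma subst_disj: "subst s (disj \<Phi>s) = disj (map (subst s) \<Phi>s)"
  by (induction \<Phi>s rule: disj.induct) auto

text \<open>Instantiation handles one variable at a time, so the variables are restored one by one;
  after \<open>m\<close> steps those below \<open>m\<close> are back. The steps do not interfere,
  since all variables of \<open>\<Theta>\<close> lie below \<open>N\<close> and all shifted ones do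
  not.\<close>

lemma der_unshift:
  assumes "subst (\<lambda>x. Var (x + N)) \<Theta> \<in> der \<sigma> T" "T \<subseteq> Sent \<sigma>" "fv \<Theta> \<union> bv \<Theta> \<subseteq> {..<N}"
  shows "\<Theta> \<in> der \<sigma> T"
proof -
  have "subst (\<lambda>x. if x < m then Var x else Var (x + N)) \<Theta> \<in> der \<sigma> T" for m
  proof (induction m)
    case 0
    then show ?case using assms(1) by simp
  next
    case (Suc m)
    let ?s = "\<lambda>x. if x < m then Var x else Var (x + N)"
    have free: "free_for (Var m) (m + N) (subst ?s \<Theta>)"
      by (rule free_for_Var_subst) (use assms(3) in \<open>auto split: if_splits\<close>)
    have "subst1 (m + N) (Var m) (subst ?s \<Theta>) =
        subst (\<lambda>z. subst_trm (Var(m + N := Var m)) (?s z)) \<Theta>"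
      unfolding subst1_def by (rule subst_subst) (use assms(3) in auto)
    also have "\<dots> = subst (\<lambda>x. if x < Suc m then Var x else Var (x + N)) \<Theta>"
      by (rule subst_cong) (use assms(3) in auto)
    finally show ?case using der_subst1[OF Suc assms(2) free] by simp
  qed
  moreover have "subst (\<lambda>x. if x < N then Var x else Var (x + N)) \<Theta> = subst Var \<Theta>"
    by (rule subst_cong) (use assms(3) in auto)
  ultimately show ?thesis by (metis subst_Var)
qed

lemma completeness:
  fixes \<sigma> :: "('p, 'c) signature" and \<Gamma> \<Delta> :: "('p, 'c) fm set"
  assumes \<Gamma>: "\<Gamma> \<subseteq> Sent \<sigma>" and \<Delta>: "\<Delta> \<subseteq> Form \<sigma>"
    and ent: "QB3K_entails TYPE(('p, 'c) world) TYPE(('p, 'c) elem) \<sigma> \<Gamma> \<Delta>"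
  shows "QB3K_derives \<sigma> \<Gamma> \<Delta>"
proof (rule ccontr)
  assume nder: "\<not> QB3K_derives \<sigma> \<Gamma> \<Delta>"
  let ?\<tau> = "lang \<sigma> (layer \<sigma> 0)"
  define C :: "('p, 'c) fm \<Rightarrow> ('p, ('p, 'c) elem) fm" where "C = repl (\<lambda>c. Cst (Con c))"
  define P where "P \<Psi> = subst (\<lambda>x. Cst (Par x)) (C \<Psi>)" for \<Psi>
  let ?S = "C ` \<Gamma> \<union> (\<lambda>\<Psi>. Neg (P \<Psi>)) ` \<Delta>"
  have C: "wf_fm ?\<tau> (C \<Phi>)" "fv (C \<Phi>) = fv \<Phi>" if "wf_fm \<sigma> \<Phi>" for \<Phi>
    using wf_repl[of ?\<tau> \<sigma> "\<lambda>c. Cst (Con c)" \<Phi>] that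
    by (auto simp: C_def fv_repl_closed layer_def)
  have P: "P \<Psi> \<in> Sent ?\<tau>" if "wf_fm \<sigma> \<Psi>" for \<Psi>
    using C[OF that] fv_subst[of "\<lambda>x. Cst (Par x)" "C \<Psi>"]
    by (auto simp: P_def Sent_iff layer_def intro!: wf_subst)
  have S: "?S \<subseteq> Sent ?\<tau>"
    using C P \<Gamma> \<Delta> by (auto simp: Sent_iff Form_def)
  have "Bot \<notin> der ?\<tau> ?S"
  proof
    assume "Bot \<in> der ?\<tau> ?S"
    from der_finite[OF this] obtain F where F: "finite F" "F \<subseteq> ?S" "Bot \<in> der ?\<tau> F" by blast
    have "finite (F - C ` \<Gamma>)" "F - C ` \<Gamma> \<subseteq> (\<lambda>\<Psi>. Neg (P \<Psi>)) ` \<Delta>" using F by auto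
    then obtain E where E: "E \<subseteq> \<Delta>" "finite E" "F - C ` \<Gamma> = (\<lambda>\<Psi>. Neg (P \<Psi>)) ` E"
      by (auto dest: finite_subset_image)
    obtain \<Psi>s where \<Psi>s: "set \<Psi>s = E" using finite_list[OF E(2)] by blast
    have Bot: "Bot \<in> der ?\<tau> (C ` \<Gamma> \<union> (\<lambda>\<Psi>. Neg (P \<Psi>)) ` set \<Psi>s)"
      by (rule der_mono[OF F(3)]) (use E(3) \<Psi>s in auto)
    obtain V where V: "finite V"
      "\<And>r. (\<And>c. fv_trm (r c) \<inter> V = {}) \<Longrightarrow> (\<And>c. c \<in> csyms ?\<tau> \<Longrightarrow> wf_trm \<sigma> (r c)) \<Longrightarrow>
        repl r Bot \<in> der \<sigma> (repl r ` (C ` \<Gamma> \<union> (\<lambda>\<Psi>. Neg (P \<Psi>)) ` set \<Psi>s))"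
      by (rule der_repl[OF _ _ Bot, of \<sigma>]) (simp, simp, iprover)
    let ?\<Theta> = "disj \<Psi>s"
    have "finite (V \<union> fv ?\<Theta> \<union> bv ?\<Theta>)" using V(1) by simp
    then obtain N where N: "V \<union> fv ?\<Theta> \<union> bv ?\<Theta> \<subseteq> {..<N}"
      using finite_nat_set_iff_bounded by (metis lessThan_iff subsetI)
    \<comment> \<open>A parameter \<open>Par k\<close> cannot become \<open>Var k\<close>, which may
      be quantified in the derivation or captured in \<open>\<Theta>\<close>; variables from
      \<open>N\<close> on are safe. No witness occurs in layer \<open>0\<close>, but the condition
      on \<open>V\<close> ranges over all elements, so witnesses also need a value that avoids
      \<open>V\<close>.\<close>
    define r :: "('p, 'c) elem \<Rightarrow> 'c trm" where
      "r e = (case e of Con c \<Rightarrow> Cst c | Par k \<Rightarrow> Var (k + N) | Wit _ _ \<Rightarrow> Var N)" for e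
    have r: "r (Con c) = Cst c" "r (Par k) = Var (k + N)" for c k by (auto simp: r_def)
    have rC: "repl r (C \<Phi>) = \<Phi>" for \<Phi>
      unfolding C_def repl_repl by (rule repl_id) (simp add: r)
    have rP: "repl r (P \<Psi>) = subst (\<lambda>x. Var (x + N)) \<Psi>" for \<Psi>
    proof -
      \<comment> \<open>The constants of \<open>C \<Psi>\<close> are sent to closed terms, so the
        only variables introduced by \<open>r\<close> are those replacing parameters, as
        \<open>repl_subst\<close> requires.\<close>
      have "set2_fm (C \<Psi>) \<subseteq> range Con"
        unfolding C_def map_fm_eq_repl[symmetric] by (auto simp: fm.set_map)
      then have "repl r (P \<Psi>) = subst (\<lambda>x. repl_trm r (Cst (Par x))) (repl r (C \<Psi>))"
        unfolding P_def by (intro repl_subst) (auto simp: r)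
      then show ?thesis by (simp add: rC r)
    qed
    have "repl r Bot \<in> der \<sigma> (repl r ` (C ` \<Gamma> \<union> (\<lambda>\<Psi>. Neg (P \<Psi>)) ` set \<Psi>s))"
    proof (rule V(2))
      show "fv_trm (r e) \<inter> V = {}" for e using N by (cases e) (auto simp: r_def)
      show "wf_trm \<sigma> (r e)" if "e \<in> csyms ?\<tau>" for e using that by (auto simp: layer_def r)
    qed
    moreover have "repl r ` (C ` \<Gamma> \<union> (\<lambda>\<Psi>. Neg (P \<Psi>)) ` set \<Psi>s) =
        \<Gamma> \<union> Neg ` set (map (subst (\<lambda>x. Var (x + N))) \<Psi>s)"
      by (simp add: image_Un image_image rC rP)
    ultimately have "Bot \<in> der \<sigma> (\<Gamma> \<union> Neg ` set (map (subst (\<lambda>x. Var (x + N))) \<Psi>s))" by simp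
    then have "disj (map (subst (\<lambda>x. Var (x + N))) \<Psi>s) \<in> der \<sigma> \<Gamma>"
      using Sent_Form[OF \<Gamma>] \<Delta> E(1) \<Psi>s
      by (intro der_disj) (auto simp: Form_def intro!: wf_subst)
    then have "subst (\<lambda>x. Var (x + N)) ?\<Theta> \<in> der \<sigma> \<Gamma>" by (simp add: subst_disj)
    then have "?\<Theta> \<in> der \<sigma> \<Gamma>" by (rule der_unshift) (use \<Gamma> N in auto)
    then have "?\<Theta> \<in> obtainable (\<Gamma> \<union> QB3K \<sigma>)" by (rule der_obtainable)
    then show False using nder E(1) \<Psi>s by (auto simp: QB3K_derives_def Disj_def)
  qed
  then obtain T where T: "?S \<subseteq> T" "mcs (lang \<sigma> (layer \<sigma> (Suc 0))) T"
    "henkin (lang \<sigma> (layer \<sigma> (Suc 0))) T"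
    by (rule henkin_extension[OF S])
  \<comment> \<open>The parameters live in layer \<open>0\<close>; the Henkin extension of
    \<open>?S\<close> uses one more layer, which puts the refuting world at level \<open>1\<close>.
    Under \<open>?l\<close> a formula of \<open>\<Delta>\<close> is translated to
    \<open>P \<Psi>\<close>, whose negation was put into \<open>?S\<close>.\<close>
  let ?w = "(T, layer \<sigma> (Suc 0))" and ?l = "\<lambda>x. name (Par x) :: ('c + ('p, 'c) elem) trm"
  have w: "?w \<in> canon_worlds \<sigma>" using T by (auto simp: canon_worlds_def)
  have lift: "repl den (lift_fm \<Phi>) = C \<Phi>" for \<Phi> :: "('p, 'c) fm"
    by (simp add: map_fm_eq_repl repl_repl C_def)
  have wf_lift: "wf_fm (expand \<sigma> (layer \<sigma> (Suc 0))) (lift_fm \<Phi>)" if "wf_fm \<sigma> \<Phi>" for \<Phi> :: "('p, 'c) fm"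
    unfolding map_fm_eq_repl by (rule wf_repl[OF _ _ _ that]) (auto simp: expand_def)
  have "\<exists>\<Psi>\<in>\<Delta>. verified (canon \<sigma>) ?w (subst ?l (lift_fm \<Psi>))"
  proof (rule ent[unfolded QB3K_entails_def, rule_format])
    show "QB3K_model \<sigma> (canon \<sigma>)" using w by (intro canon_QB3K_model) auto
    show "?w \<in> worlds (canon \<sigma>)" using w by simp
    show "ground_subst (domain (pos (canon \<sigma>) ?w)) ?l" by (auto simp: ground_subst_def layer_def)
    fix \<Phi> assume "\<Phi> \<in> \<Gamma>"
    then have "wf_fm \<sigma> \<Phi>" "fv \<Phi> = {}" "C \<Phi> \<in> T" using \<Gamma> T(1) by (auto simp: Sent_def Form_def)
    then show "verified (canon \<sigma>) ?w (lift_fm \<Phi>)"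
      using truth_lemma[OF w, of "lift_fm \<Phi>"] wf_lift by (simp add: Sent_iff lift)
  qed
  then obtain \<Psi> where \<Psi>: "\<Psi> \<in> \<Delta>" "verified (canon \<sigma>) ?w (subst ?l (lift_fm \<Psi>))" by blast
  have wf: "wf_fm \<sigma> \<Psi>" using \<Psi>(1) \<Delta> by (auto simp: Form_def)
  have "wf_fm (expand \<sigma> (layer \<sigma> (Suc 0))) (subst ?l (lift_fm \<Psi>))"
    by (rule wf_subst[OF wf_lift[OF wf]]) (auto simp: expand_def layer_def)
  moreover have "fv (subst ?l (lift_fm \<Psi>)) = {}" using fv_subst[of ?l "lift_fm \<Psi>"] by auto
  moreover have "repl den (subst ?l (lift_fm \<Psi>)) = P \<Psi>"
    by (subst repl_subst) (auto simp: P_def lift)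
  ultimately have "P \<Psi> \<in> T"
    using truth_lemma[OF w, of "subst ?l (lift_fm \<Psi>)"] \<Psi>(2) by (simp add: Sent_iff)
  moreover have "Neg (P \<Psi>) \<in> T" using T(1) \<Psi>(1) by auto
  ultimately show False
    using mcs_Neg[OF T(2) Sent_lang_mono[OF P[OF wf] layer_mono]] by simp
qed

text \<open>The second conjunct shows that fixing the types of worlds and individuals in the first
  loses nothing: entailment over the canonical types gives derivability, and this gives entailment
  over any other types.\<close>

theorem theorem17:
  fixes \<sigma> :: "('p, 'c) signature" and \<Gamma> \<Delta> :: "('p, 'c) fm set"
  assumes "\<Gamma> \<subseteq> Sent \<sigma>" and "\<Delta> \<subseteq> Form \<sigma>"
  shows "(QB3K_derives \<sigma> \<Gamma> \<Delta> \<longleftrightarrow>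
            QB3K_entails TYPE(('p, 'c) world) TYPE(('p, 'c) elem) \<sigma> \<Gamma> \<Delta>) \<and>
         (QB3K_derives \<sigma> \<Gamma> \<Delta> \<longrightarrow> QB3K_entails TYPE('w) TYPE('a) \<sigma> \<Gamma> \<Delta>)"
  by (intro conjI iffI impI; rule soundness[OF assms(1)] completeness[OF assms]; assumption)

end
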